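(* Let $m\ge 1$ be an integer, $T>0$, and let $d\ge 4$. Suppose that $a\in C^{d+1}[0,T]$, $K\in C^{d+1}[0,T]$, $K(0)=1$, and $a^{(p)}(0)=0$ for $p=0,1,\dots,d+1$. Let $u$ be the solution of $\int_0^t K(t')\,u(t-t')\,dt'=a(t)$, $t\in[0,T]$, and for $h>0$ and $n\ge1$ with $t_n=nh\le T$ let $e_n$ be the approximation error of the degree-$m$ convolution B-spline scheme. Then there is a constant $C$, independent of $n$ and $h$, such that for all sufficiently small $h$ and all $n\ge1$ with $t_n\le T$, $$|e_n(t)|\le C\,h^2\qquad\text{for all } t\in[t_m,T].$$ If $m=1$, then this bound holds for all $t\in[0,T]$.
   Context: Under the stated hypotheses the Volterra equation $\int_0^t K(t')\,u(t-t')\,dt'=a(t)$, $t\in[0,T]$, has a unique solution $u\in C^d[0,T]$, which is extended by zero to the negative real axis (the extension is in $C^d(-\infty,T]$). B-splines. Let $h>0$, knots $t_j=jh$ for $j\ge0$ and $t_j=0$ for $j=-m,\dots,-1$. Set $b^0_j(t)=1$ if $t\in[t_j,t_{j+1})$ and $j\ge 0$, and $b^0_j(t)=0$ otherwise. For degree $k>0$, $$b^k_j(t)=\frac{t-t_j}{t_{j+k}-t_j}\,b^{k-1}_j(t)+\frac{t_{j+k+1}-t}{t_{j+k+1}-t_{j+1}}\,b^{k-1}_{j+1}(t),$$ where $0/0$ is interpreted as $0$ and $b^k_j\equiv0$ for $j<-k$. The degree-$m$ B-splines are $b^m_j$, $j\ge-m$; $b_j^m$ vanishes outside $[t_j,t_{j+m+1})$.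 Scheme. The weights are $q_j=\int_{t_{j-m}}^{t_{j+1}}K(t)\,b^m_{j-m}(t)\,dt$ for $j\ge0$, and the coefficients $v_j$ are determined by $a(t_n)=\sum_{j=0}^n q_j\,v_{n-j}$ for $n\ge 0$, $t_n\le T$. (Since $a(0)=0$, $v_0=0$, so the $j=n$ term vanishes and only values of $K$ on $[0,t_n]$ are used.) The approximation error is, for $n>0$ and $t\ge0$, $$e_n(t)=u(t_n-t)-\sum_{j=0}^n v_{n-j}\,b^m_{j-m}(t).$$ *)

theory Defs
  imports "HOL-Analysis.Analysis"
begin

text \<open>Derivatives of order k relative to a set S, so one-sided at the end points
  when S is a compact interval.\<close>

primrec deriv_within :: "real set \<Rightarrow> nat \<Rightarrow> (real \<Rightarrow> real) \<Rightarrow> real \<Rightarrow> real" where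
  "deriv_within S 0 f = f"
| "deriv_within S (Suc k) f = (\<lambda>t. vector_derivative (deriv_within S k f) (at t within S))"

definition C_k_on :: "nat \<Rightarrow> (real \<Rightarrow> real) \<Rightarrow> real set \<Rightarrow> bool" where
  "C_k_on k f S \<longleftrightarrow>
     (\<forall>i<k. deriv_within S i f differentiable_on S) \<and> (\<forall>i\<le>k. continuous_on S (deriv_within S i f))"

text \<open>Only continuity of u is demanded here; its higher regularity follows from that of K and a.\<close>

definition volterra_solution ::
  "(real \<Rightarrow> real) \<Rightarrow> (real \<Rightarrow> real) \<Rightarrow> real \<Rightarrow> (real \<Rightarrow> real) \<Rightarrow> bool" where
  "volterra_solution K a T u \<longleftrightarrow>
     continuous_on {0..T} u \<and>
     (\<forall>t\<in>{0..T}. integral {0..t} (\<lambda>s. K s * u (t - s)) = a t)"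

definition zero_ext :: "(real \<Rightarrow> real) \<Rightarrow> real \<Rightarrow> real" where
  "zero_ext u t = (if t < 0 then 0 else u t)"

definition knot :: "real \<Rightarrow> int \<Rightarrow> real" where
  "knot h j = (if 0 \<le> j then of_int j * h else 0)"

text \<open>The convention 0/0 = 0 of the recursion is built into division on the reals.\<close>

primrec bspline :: "real \<Rightarrow> nat \<Rightarrow> int \<Rightarrow> real \<Rightarrow> real" where
  "bspline h 0 j t = (if 0 \<le> j \<and> knot h j \<le> t \<and> t < knot h (j + 1) then 1 else 0)"
| "bspline h (Suc k) j t =
     (if j < - int (Suc k) then 0
      else (t - knot h j) / (knot h (j + int (Suc k)) - knot h j) * bspline h k j t
         + (knot h (j + int (Suc k) + 1) - t) / (knot h (j + int (Suc k) + 1) - knot h (j + 1))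
             * bspline h k (j + 1) t)"

definition weight :: "(real \<Rightarrow> real) \<Rightarrow> nat \<Rightarrow> real \<Rightarrow> nat \<Rightarrow> real" where
  "weight K m h j =
     integral {knot h (int j - int m)..knot h (int j + 1)}
       (\<lambda>t. K t * bspline h m (int j - int m) t)"

text \<open>For n with t_n in [0,T], the weight with index n may involve values of K beyond T, but it
  is multiplied by v 0, which is 0 because a 0 = 0 (as soon as the weight with index 0 is nonzero).\<close>

definition scheme_coeffs ::
  "(real \<Rightarrow> real) \<Rightarrow> (real \<Rightarrow> real) \<Rightarrow> real \<Rightarrow> nat \<Rightarrow> real \<Rightarrow> (nat \<Rightarrow> real) \<Rightarrow> bool" where
  "scheme_coeffs K a T m h v \<longleftrightarrow>
     (\<forall>n. knot h (int n) \<le> T \<longrightarrow> a (knot h (int n)) = (\<Sum>j=0..n. weight K m h j * v (n - j)))"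

definition approx_error ::
  "(real \<Rightarrow> real) \<Rightarrow> nat \<Rightarrow> real \<Rightarrow> (nat \<Rightarrow> real) \<Rightarrow> nat \<Rightarrow> real \<Rightarrow> real" where
  "approx_error u m h v n t =
     zero_ext u (knot h (int n) - t)
       - (\<Sum>j=0..n. v (n - j) * bspline h m (int j - int m) t)"

text \<open>The linear system is triangular: if the weight with index 0 is nonzero, it has a solution,
  and any two solutions agree at all indices n with t_n in [0,T].\<close>

lemma scheme_coeffs_exists:
  assumes "weight K m h 0 \<noteq> 0"
  shows "\<exists>v. scheme_coeffs K a T m h v"
proof -
  let ?q = "weight K m h"
  define F where "F = (\<lambda>v n. (a (knot h (int n)) - (\<Sum>j=1..n. ?q j * v (n - j))) / ?q 0)"
  define v where "v = wfrec less_than F"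
  have adm: "adm_wf less_than F"
    unfolding adm_wf_def F_def by (auto intro!: sum.cong)
  have v: "v n = F v n" for n
    unfolding v_def using wfrec_fixpoint[OF wf_less_than adm] by metis
  have "a (knot h (int n)) = (\<Sum>j=0..n. ?q j * v (n - j))" for n
  proof -
    have "(\<Sum>j=0..n. ?q j * v (n - j)) = ?q 0 * v n + (\<Sum>j=1..n. ?q j * v (n - j))"
      by (simp add: sum.atLeast_Suc_atMost)
    then show ?thesis
      using v[of n] assms by (simp add: F_def)
  qed
  then show ?thesis
    unfolding scheme_coeffs_def by blast
qed

lemma scheme_coeffs_unique:
  assumes "weight K m h 0 \<noteq> 0" "0 < h"
    and "scheme_coeffs K a T m h v" "scheme_coeffs K a T m h w"
    and "knot h (int n) \<le> T"
  shows "v n = w n"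
  using assms(5)
proof (induction n rule: less_induct)
  case (less n)
  let ?q = "weight K m h"
  have split: "(\<Sum>j=0..n. ?q j * x (n - j)) = ?q 0 * x n + (\<Sum>j=1..n. ?q j * x (n - j))"
    for x :: "nat \<Rightarrow> real"
    by (simp add: sum.atLeast_Suc_atMost)
  have "v (n - j) = w (n - j)" if "j \<in> {1..n}" for j
  proof (rule less.IH)
    show "n - j < n" using that by auto
    have "real (n - j) * h \<le> real n * h"
      using assms(2) by (intro mult_right_mono) auto
    then show "knot h (int (n - j)) \<le> T"
      using less.prems by (simp add: knot_def)
  qed
  then have "(\<Sum>j=1..n. ?q j * v (n - j)) = (\<Sum>j=1..n. ?q j * w (n - j))"
    by (intro sum.cong) auto
  moreover have "(\<Sum>j=0..n. ?q j * v (n - j)) = (\<Sum>j=0..n. ?q j * w (n - j))"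
    using assms(3,4) less.prems unfolding scheme_coeffs_def by metis
  ultimately show ?case
    using assms(1) by (simp only: split) simp
qed

lemma bspline_first:
  assumes "0 < h" "0 \<le> t" "t < h"
  shows "bspline h k (- int k) t = ((h - t) / h) ^ k"
proof (induction k)
  case 0
  then show ?case using assms by (simp add: knot_def)
next
  case (Suc k)
  have "- int (Suc k) + 1 = - int k" by simp
  then show ?case
    using Suc by (simp add: knot_def)
qed

lemma weight_0_nonzero:
  assumes K: "continuous_on {0..T} K" "K 0 = 1" and T: "0 < T"
  shows "\<forall>\<^sub>F h in at_right 0. weight K m h 0 \<noteq> 0"
proof -
  obtain e where e: "e > 0" "\<And>x. x \<in> {0..T} \<Longrightarrow> dist x 0 < e \<Longrightarrow> dist (K x) (K 0) < 1/2"
    using continuous_onE[OF K(1), of 0 "1/2"] T by (metis atLeastAtMost_iff half_gt_zero_iff less_imp_le order_refl zero_less_one)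
  have "weight K m h 0 \<noteq> 0" if h: "0 < h" "h < min e T" for h
  proof -
    let ?f = "\<lambda>t. K t * ((h - t) / h) ^ m"
    have "integral {0..h} ?f = integral {0..h} (\<lambda>t. K t * bspline h m (- int m) t)"
    proof (rule integral_spike[of "{h}"])
      fix t assume "t \<in> {0..h} - {h}"
      then show "K t * bspline h m (- int m) t = ?f t"
        using bspline_first[of h t m] h by simp
    qed simp
    then have w: "weight K m h 0 = integral {0..h} ?f"
      by (simp add: weight_def knot_def)
    have cont: "continuous_on {0..h} ?f"
      using h by (intro continuous_intros continuous_on_subset[OF K(1)]) auto
    have pos: "0 \<le> ?f t" if "t \<in> {0..h}" for t
    proof -
      have "dist (K t) (K 0) < 1/2" using e(2)[of t] that h by (auto simp: dist_real_def)
      then have "0 \<le> K t" using K(2) by (simp add: dist_real_def abs_if split: if_splits)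
      then show ?thesis using that h by simp
    qed
    show ?thesis
    proof
      assume "weight K m h 0 = 0"
      then have "(?f has_integral 0) {0..h}"
        using w integrable_continuous_interval[OF cont] by (metis integrable_integral)
      then have "?f 0 = 0"
        using has_integral_0_cbox_imp_0[of 0 h ?f 0] cont pos h by (simp add: cbox_interval box_real)
      then show False using K(2) h by simp
    qed
  qed
  then show ?thesis
    unfolding eventually_at_right_field using e(1) T by (intro exI[of _ "min e T"]) auto
qed

end

theory Submission
  imports Defs
begin

text \<open>Put \<open>w = u + (m - 1) h / 2 u'\<close>. The interior spline \<open>b\<^sup>m\<^sub>j\<^sub>-\<^sub>m\<close> has its Greville point at
  \<open>t\<^sub>j - (m - 1) h / 2\<close>, so by Marsden's identity the spline with coefficients \<open>w (t\<^sub>n - t\<^sub>j)\<close> reproduces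
  \<open>u (t\<^sub>n - t)\<close> up to \<open>O(h\<^sup>2)\<close> for \<open>t \<ge> t\<^sub>m\<close>, and up to \<open>O(h)\<close> on \<open>[0, t\<^sub>m]\<close>. Hence the residual of
  \<open>w\<close> in the linear system is \<open>O(h\<^sup>2)\<close>, and, as the estimate applies equally to second differences
  of \<open>u\<close>, the second difference of the residual is \<open>O(h\<^sup>4)\<close>.

  For \<open>K = 1\<close> the weights are \<open>h min(j + 1, m + 1) / (m + 1)\<close>, and their second difference is
  \<open>h / (m + 1)\<close> at \<open>j = 0\<close>, \<open>- h / (m + 1)\<close> at \<open>j = m + 1\<close>, and zero elsewhere. For general \<open>K\<close> this is
  perturbed by \<open>O(h\<^sup>2)\<close> for \<open>j \<le> m + 1\<close> and by \<open>O(h\<^sup>3)\<close> for larger \<open>j\<close>, because interior splines are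
  translates of each other. Thus \<open>\<epsilon>\<^sub>n = v\<^sub>n - w (t\<^sub>n)\<close> satisfies
  \<open>\<bar>\<epsilon>\<^sub>n - \<epsilon>\<^sub>n\<^sub>-\<^sub>m\<^sub>-\<^sub>1\<bar> \<le> A h max\<^sub>i\<^sub>\<le>\<^sub>n \<bar>\<epsilon>\<^sub>i\<bar> + A h\<^sup>3\<close>, and a discrete Gronwall argument gives \<open>\<epsilon>\<^sub>n = O(h\<^sup>2)\<close>.\<close>

section \<open>B-splines with a multiple knot at the origin\<close>

lemma knot_mono: "0 < h \<Longrightarrow> i \<le> j \<Longrightarrow> knot h i \<le> knot h j"
  by (auto simp: knot_def intro: mult_right_mono)

lemma bspline_index: "j < - int k \<Longrightarrow> bspline h k j t = 0"
  by (cases k) auto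

lemma bspline_support:
  assumes "0 < h" "t < knot h j \<or> knot h (j + int k + 1) \<le> t"
  shows "bspline h k j t = 0"
  using assms(2)
proof (induction k arbitrary: j)
  case 0
  then show ?case by auto
next
  case (Suc k)
  have "bspline h k j t = 0"
    using Suc.prems knot_mono[OF assms(1), of "j + int k + 1" "j + int (Suc k) + 1"]
    by (intro Suc.IH) linarith
  moreover have "bspline h k (j + 1) t = 0"
    using Suc.prems knot_mono[OF assms(1), of j "j + 1"]
    by (intro Suc.IH) (auto simp: algebra_simps)
  ultimately show ?case by simp
qed

text \<open>The scaling under which all splines of degree \<open>k\<close> have the same integral \<open>1 / (k + 1)\<close>; splines
  with coinciding knots vanish, in agreement with division by zero.\<close>

definition nspline :: "real \<Rightarrow> nat \<Rightarrow> int \<Rightarrow> real \<Rightarrow> real" where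
  "nspline h k j t = bspline h k j t / (knot h (j + int k + 1) - knot h j)"

lemma nspline_index: "j < - int k \<Longrightarrow> nspline h k j t = 0"
  by (simp add: nspline_def bspline_index)

lemma nspline_degenerate: "knot h (j + int k + 1) = knot h j \<Longrightarrow> nspline h k j t = 0"
  by (simp add: nspline_def)

text \<open>If the outer knots coincide, the quotient is 0, but then the support is empty and the
  B-spline is 0 as well.\<close>

lemma nspline_mult:
  assumes "0 < h"
  shows "(knot h (j + int k + 1) - knot h j) * nspline h k j t = bspline h k j t"
  using bspline_support[OF assms, of t j k] by (cases "t < knot h j") (auto simp: nspline_def)

text \<open>For \<open>j < - int (Suc k)\<close> both normalised splines vanish by their index,
  which absorbs the cut-off in the definition.\<close>

lemma bspline_rec:
  "bspline h (Suc k) j t =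
     (t - knot h j) * nspline h k j t + (knot h (j + int k + 2) - t) * nspline h k (j + 1) t"
proof (cases "j < - int (Suc k)")
  case True
  then show ?thesis by (simp add: nspline_index)
next
  case False
  have e: "j + int (Suc k) = j + int k + 1" "j + 1 + int k + 1 = j + int k + 2"
      "j + int k + 1 + 1 = j + int k + 2" by simp_all
  show ?thesis
    using False by (simp only: bspline.simps nspline_def e) simp
qed

text \<open>A linear factor of the recursion is negative only outside the support of the spline it
  multiplies.\<close>

lemma bspline_nonneg:
  assumes "0 < h"
  shows "0 \<le> bspline h k j t"
proof (induction k arbitrary: j)
  case 0
  then show ?case by simp
next
  case (Suc k)
  have n: "0 \<le> nspline h k i t" for i
    using Suc knot_mono[OF assms, of i "i + int k + 1"] by (simp add: nspline_def)
  have "0 \<le> (t - knot h j) * nspline h k j t"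
  proof (cases "t < knot h j")
    case True
    then have "bspline h k j t = 0" by (intro bspline_support[OF assms]) simp
    then show ?thesis by (simp add: nspline_def)
  next
    case False
    then show ?thesis using n[of j] by simp
  qed
  moreover have "0 \<le> (knot h (j + int k + 2) - t) * nspline h k (j + 1) t"
  proof (cases "knot h (j + int k + 2) \<le> t")
    case True
    then have "bspline h k (j + 1) t = 0"
      by (intro bspline_support[OF assms]) (auto simp: algebra_simps)
    then show ?thesis by (simp add: nspline_def)
  next
    case False
    then show ?thesis using n[of "j + 1"] by simp
  qed
  ultimately show ?case unfolding bspline_rec by simp
qed

section \<open>Derivatives and continuity of the splines\<close>

lemma bspline_0_has_derivative_0:
  assumes "\<And>i. t \<noteq> knot h i"
  shows "(bspline h 0 j has_real_derivative 0) (at t)"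
proof -
  let ?S = "- {knot h j, knot h (j + 1)}"
  have o: "open ?S" by (intro open_Compl finite_imp_closed) simp
  consider "t < knot h j" | "knot h j < t" "t < knot h (j + 1)" | "knot h (j + 1) < t"
    using assms by (metis linorder_neqE)
  then have "\<exists>U. open U \<and> t \<in> U \<and> (\<forall>x\<in>U. bspline h 0 j t = bspline h 0 j x)"
  proof cases
    case 1
    then show ?thesis by (intro exI[of _ "{..<knot h j}"]) auto
  next
    case 2
    then show ?thesis by (intro exI[of _ "{knot h j<..<knot h (j + 1)}"]) auto
  next
    case 3
    then show ?thesis by (intro exI[of _ "{knot h (j + 1)<..}"]) auto
  qed
  then obtain U where U: "open U" "t \<in> U" "\<And>x. x \<in> U \<Longrightarrow> bspline h 0 j t = bspline h 0 j x"
    by blast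
  show ?thesis
    by (rule has_field_derivative_transform_within_open[OF DERIV_const U])
qed

text \<open>Induction on the degree, at points off the knots, where splines of degree 0 are locally
  constant. The product rule applied to the recursion yields linear factors times the derivatives
  \<open>D\<close>, which must be rewritten in splines.\<close>

lemma bspline_has_derivative:
  assumes h: "0 < h" and t: "\<And>i. t \<noteq> knot h i"
  shows "(bspline h (Suc k) j has_real_derivative
           real (Suc k) * (nspline h k j t - nspline h k (j + 1) t)) (at t)"
proof (induction k arbitrary: j)
  case 0
  have d: "(nspline h 0 j has_real_derivative 0) (at t)" for j
    using DERIV_cdivide[OF bspline_0_has_derivative_0[OF t]] by (simp add: nspline_def[abs_def])
  have "((\<lambda>t. (t - knot h j) * nspline h 0 j t + (knot h (j + 2) - t) * nspline h 0 (j + 1) t)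
      has_real_derivative nspline h 0 j t - nspline h 0 (j + 1) t) (at t)"
    by (auto intro!: derivative_eq_intros d)
  moreover have "bspline h (Suc 0) j =
      (\<lambda>t. (t - knot h j) * nspline h 0 j t + (knot h (j + 2) - t) * nspline h 0 (j + 1) t)"
    by (rule ext, subst bspline_rec) simp
  ultimately show ?case by simp
next
  case (Suc k)
  let ?n = "nspline h k" and ?N = "nspline h (Suc k)" and ?c = "real (Suc k)"
  define D where "D j = ?c * (?n j t - ?n (j + 1) t) / (knot h (j + int (Suc k) + 1) - knot h j)" for j
  have d: "(?N j has_real_derivative D j) (at t)" for j
  proof -
    have "?N j = (\<lambda>t. bspline h (Suc k) j t / (knot h (j + int (Suc k) + 1) - knot h j))"
      by (simp add: nspline_def fun_eq_iff)
    then show ?thesis using DERIV_cdivide[OF Suc[of j]] unfolding D_def by simp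
  qed
  have cancel: "?N j t * (knot h (j + int (Suc k) + 1) - knot h j) = bspline h (Suc k) j t" for j
    using nspline_mult[OF h, of j "Suc k" t] by (simp add: mult.commute)
  \<comment> \<open>In the sum of \<open>left\<close> at \<open>j\<close> and \<open>right\<close>
    at \<open>j + 1\<close> the terms \<open>?n (j + 1) t\<close> cancel, leaving \<open>?c\<close>
    times the desired difference. If the outer knots coincide, every term is 0 by division by
    zero.\<close>
  have left: "(t - knot h j) * D j = ?c * (?N j t - ?n (j + 1) t)" for j
  proof (cases "knot h (j + int (Suc k) + 1) = knot h j")
    case True
    have "knot h (j + 1 + int k + 1) = knot h (j + 1)"
      using True knot_mono[OF h, of j "j + 1"] knot_mono[OF h, of "j + 1" "j + 1 + int k + 1"]
      by (simp add: algebra_simps)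
    then have "?n (j + 1) t = 0" by (rule nspline_degenerate)
    moreover have "?N j t = 0" by (rule nspline_degenerate[OF True])
    moreover have "D j = 0" unfolding D_def True by simp
    ultimately show ?thesis by simp
  next
    case False
    have e: "(t - knot h j) * (?n j t - ?n (j + 1) t)
        = (knot h (j + int (Suc k) + 1) - knot h j) * (?N j t - ?n (j + 1) t)"
      using cancel[of j] bspline_rec[of h k j t] by (simp add: algebra_simps)
    have "(t - knot h j) * D j = ?c * ((t - knot h j) * (?n j t - ?n (j + 1) t))
        / (knot h (j + int (Suc k) + 1) - knot h j)"
      unfolding D_def by (simp add: mult.left_commute)
    then show ?thesis using False unfolding e by simp
  qed
  have right: "(knot h (j + int (Suc k) + 1) - t) * D j = ?c * (?n j t - ?N j t)" for j
  proof (cases "knot h (j + int (Suc k) + 1) = knot h j")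
    case True
    have "knot h (j + int k + 1) = knot h j"
      using True knot_mono[OF h, of j "j + int k + 1"]
        knot_mono[OF h, of "j + int k + 1" "j + int (Suc k) + 1"]
      by (simp add: algebra_simps)
    then have "?n j t = 0" by (rule nspline_degenerate)
    moreover have "?N j t = 0" by (rule nspline_degenerate[OF True])
    moreover have "D j = 0" unfolding D_def True by simp
    ultimately show ?thesis by simp
  next
    case False
    have e: "(knot h (j + int (Suc k) + 1) - t) * (?n j t - ?n (j + 1) t)
        = (knot h (j + int (Suc k) + 1) - knot h j) * (?n j t - ?N j t)"
      using cancel[of j] bspline_rec[of h k j t] by (simp add: algebra_simps)
    have "(knot h (j + int (Suc k) + 1) - t) * D j
        = ?c * ((knot h (j + int (Suc k) + 1) - t) * (?n j t - ?n (j + 1) t))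
        / (knot h (j + int (Suc k) + 1) - knot h j)"
      unfolding D_def by (simp add: mult.left_commute)
    then show ?thesis using False unfolding e by simp
  qed
  have e: "j + 1 + int (Suc k) + 1 = j + int (Suc k) + 2" by simp
  have "((\<lambda>t. (t - knot h j) * ?N j t + (knot h (j + int (Suc k) + 2) - t) * ?N (j + 1) t)
      has_real_derivative
        ?N j t + (t - knot h j) * D j + ((knot h (j + int (Suc k) + 2) - t) * D (j + 1) - ?N (j + 1) t)) (at t)"
    by (auto intro!: derivative_eq_intros d)
  moreover have "bspline h (Suc (Suc k)) j =
      (\<lambda>t. (t - knot h j) * ?N j t + (knot h (j + int (Suc k) + 2) - t) * ?N (j + 1) t)"
    by (rule ext, subst bspline_rec) simp
  moreover have "?N j t + (t - knot h j) * D j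
        + ((knot h (j + int (Suc k) + 2) - t) * D (j + 1) - ?N (j + 1) t)
      = real (Suc (Suc k)) * (?N j t - ?N (j + 1) t)"
    using left[of j] right[of "j + 1"] unfolding e by (simp add: algebra_simps)
  ultimately show ?case by metis
qed

text \<open>Restricted to nonnegative arguments because the first spline jumps from 0 to 1 at the
  origin. Degree 0 is discontinuous, so the induction starts from the hat functions of degree 1, of
  which the one with index -1 is halved by the multiple knot.\<close>

lemma continuous_on_bspline:
  assumes h: "0 < h"
  shows "continuous_on {0..} (bspline h (Suc k) j)"
proof (induction k arbitrary: j)
  case 0
  consider "j < -1" | "j = -1" | "0 \<le> j" by linarith
  then show ?case
  proof cases
    case 1
    then have "bspline h (Suc 0) j = (\<lambda>t. 0)" by (intro ext bspline_index) simp
    then show ?thesis by simp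
  next
    case 2
    have "bspline h (Suc 0) j t = max 0 ((h - t) / h)" if "t \<in> {0..}" for t
      using that h 2 by (auto simp: knot_def max_def field_simps)
    then have "continuous_on {0..} (bspline h (Suc 0) j) \<longleftrightarrow>
        continuous_on {0..} (\<lambda>t. max 0 ((h - t) / h))"
      by (intro continuous_on_cong) auto
    then show ?thesis using h by (auto intro!: continuous_intros)
  next
    case 3
    have k: "knot h j = real_of_int j * h" "knot h (j + 1) = real_of_int j * h + h"
      "knot h (j + 1 + 1) = real_of_int j * h + 2 * h" "knot h (2 + j) = real_of_int j * h + 2 * h"
      using 3 by (simp_all add: knot_def algebra_simps)
    have "bspline h (Suc 0) j t =
        max 0 (min ((t - real_of_int j * h) / h) ((real_of_int j * h + 2 * h - t) / h))" for t
    proof -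
      define x where "x = real_of_int j * h"
      have "bspline h (Suc 0) j t = (if x \<le> t \<and> t < x + h then (t - x) / h else 0)
          + (if x + h \<le> t \<and> t < x + 2 * h then (x + 2 * h - t) / h else 0)"
        using 3 h by (simp add: k x_def)
      also have "\<dots> = max 0 (min ((t - x) / h) ((x + 2 * h - t) / h))"
        using h by (auto simp: max_def min_def divide_simps)
      finally show ?thesis by (simp add: x_def)
    qed
    then have "bspline h (Suc 0) j =
        (\<lambda>t. max 0 (min ((t - real_of_int j * h) / h) ((real_of_int j * h + 2 * h - t) / h)))"
      by blast
    then show ?thesis using h by (auto intro!: continuous_intros)
  qed
next
  case (Suc k)
  have "continuous_on {0..} (nspline h (Suc k) j)" for j
    unfolding nspline_def[abs_def] divide_inverse by (intro continuous_intros Suc)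
  then show ?case
    unfolding bspline_rec[abs_def, of h "Suc k"] by (intro continuous_intros)
qed

section \<open>Values at the origin and integrals\<close>

lemma bspline_at_0:
  assumes h: "0 < h"
  shows "bspline h k j 0 = (if j = - int k then 1 else 0)"
proof (cases "j = - int k")
  case True
  then show ?thesis using bspline_first[of h 0 k] h by simp
next
  case False
  have "j \<noteq> - int k \<Longrightarrow> bspline h k j 0 = 0"
  proof (induction k arbitrary: j)
    case 0
    then have "0 < knot h j" if "0 \<le> j" using that h by (simp add: knot_def)
    then show ?case by auto
  next
    case (Suc k)
    have "bspline h k (j + 1) 0 = 0" by (rule Suc.IH) (use Suc.prems in simp)
    moreover have "knot h j * bspline h k j 0 = 0"
    proof (cases "j \<le> 0")
      case True
      then show ?thesis by (auto simp: knot_def)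
    next
      case False
      then have "0 < knot h j" using h by (simp add: knot_def)
      then show ?thesis using bspline_support[OF h] by simp
    qed
    ultimately show ?case by (auto simp: bspline_rec nspline_def)
  qed
  then show ?thesis using False by simp
qed

text \<open>The derivative formula for degree \<open>k + 1\<close> shows that consecutive normalised splines of degree
  \<open>k\<close> have the same integral; the value comes from the jump of the first spline of degree \<open>k + 1\<close> at 0.\<close>

lemma nspline_diff_has_integral:
  assumes h: "0 < h" and L: "knot h (j + int k + 2) \<le> L" "0 \<le> L"
  shows "((\<lambda>t. real (Suc k) * (nspline h k j t - nspline h k (j + 1) t))
           has_integral - bspline h (Suc k) j 0) {0..L}"
proof -
  \<comment> \<open>The fundamental theorem of calculus tolerates finitely many exceptional points;
    the positive knots below \<open>L\<close> have index at most \<open>L / h\<close>.\<close>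
  let ?S = "knot h ` {0..\<lceil>L / h\<rceil>}"
  have knots: "t \<noteq> knot h i" if "t \<in> {0<..<L} - ?S" for t i
  proof
    assume e: "t = knot h i"
    then have "0 < knot h i" "knot h i < L" using that by auto
    then have "0 \<le> i" "real_of_int i * h < L" by (auto simp: knot_def split: if_splits)
    then have "real_of_int i < L / h" using h by (simp add: field_simps)
    then have "i \<le> \<lceil>L / h\<rceil>" by linarith
    then show False using that e \<open>0 \<le> i\<close> by auto
  qed
  have "((\<lambda>t. real (Suc k) * (nspline h k j t - nspline h k (j + 1) t))
           has_integral (bspline h (Suc k) j L - bspline h (Suc k) j 0)) {0..L}"
  proof (rule fundamental_theorem_of_calculus_interior_strong[of ?S])
    show "continuous_on {0..L} (bspline h (Suc k) j)"
      by (rule continuous_on_subset[OF continuous_on_bspline[OF h]]) auto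
    fix t assume "t \<in> {0<..<L} - ?S"
    then show "(bspline h (Suc k) j has_vector_derivative
        real (Suc k) * (nspline h k j t - nspline h k (j + 1) t)) (at t)"
      using bspline_has_derivative[OF h knots] 
      by (simp add: has_real_derivative_iff_has_vector_derivative)
  qed (use L in auto)
  moreover have "bspline h (Suc k) j L = 0"
    using L by (intro bspline_support[OF h]) (auto simp: algebra_simps)
  ultimately show ?thesis by simp
qed

lemma nspline_integral:
  assumes h: "0 < h" and j: "- int (Suc k) \<le> j" and L: "knot h (j + int (Suc k) + 1) \<le> L"
  shows "integral {0..L} (nspline h (Suc k) j) = 1 / real (Suc (Suc k))"
  using j L
proof (induction j rule: int_ge_induct)
  case base
  then have "0 \<le> L" using h by (simp add: knot_def)
  \<comment> \<open>The left neighbour of the first spline is identically 0 by its index, so the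
    identity isolates the first spline, and the value 1 at the origin fixes its integral.\<close>
  have "((\<lambda>t. real (Suc (Suc k)) * (nspline h (Suc k) (- int (Suc k) - 1) t
      - nspline h (Suc k) (- int (Suc k) - 1 + 1) t)) has_integral
      - bspline h (Suc (Suc k)) (- int (Suc k) - 1) 0) {0..L}"
    using base by (intro nspline_diff_has_integral[OF h _ \<open>0 \<le> L\<close>]) (simp add: algebra_simps)
  moreover have "bspline h (Suc (Suc k)) (- int (Suc k) - 1) 0 = 1"
    by (subst bspline_at_0[OF h]) simp
  ultimately have "((\<lambda>t. real (Suc (Suc k)) * - nspline h (Suc k) (- int (Suc k)) t) has_integral - 1) {0..L}"
    by (simp add: nspline_index del: bspline.simps)
  from has_integral_mult_right[OF this, of "- 1 / real (Suc (Suc k))"]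
  have "(nspline h (Suc k) (- int (Suc k)) has_integral 1 / real (Suc (Suc k))) {0..L}"
    by (simp add: divide_simps del: of_nat_Suc)
  then show ?case by (rule integral_unique)
next
  case (step j)
  have le: "knot h (j + int (Suc k) + 1) \<le> L"
    using step.prems knot_mono[OF h, of "j + int (Suc k) + 1" "j + 1 + int (Suc k) + 1"] by linarith
  have L0: "0 \<le> L"
    using step.prems knot_mono[OF h, of 0 "j + 1 + int (Suc k) + 1"] step.hyps by (simp add: knot_def)
  have int: "nspline h (Suc k) i integrable_on {0..L}" for i
    unfolding nspline_def[abs_def]
    by (intro integrable_on_divide integrable_continuous_interval
        continuous_on_subset[OF continuous_on_bspline[OF h]]) auto
  have "((\<lambda>t. real (Suc (Suc k)) * (nspline h (Suc k) j t
      - nspline h (Suc k) (j + 1) t)) has_integral - bspline h (Suc (Suc k)) j 0) {0..L}"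
    using step.prems by (intro nspline_diff_has_integral[OF h _ L0]) (simp add: algebra_simps)
  moreover have "bspline h (Suc (Suc k)) j 0 = 0"
    by (subst bspline_at_0[OF h]) (use step.hyps in auto)
  moreover have "((\<lambda>t. real (Suc (Suc k)) * (nspline h (Suc k) j t
      - nspline h (Suc k) (j + 1) t)) has_integral real (Suc (Suc k)) *
       (integral {0..L} (nspline h (Suc k) j) - integral {0..L} (nspline h (Suc k) (j + 1)))) {0..L}"
    by (intro has_integral_mult_right has_integral_diff integrable_integral int)
  ultimately have "real (Suc (Suc k)) *
       (integral {0..L} (nspline h (Suc k) j) - integral {0..L} (nspline h (Suc k) (j + 1))) = 0"
    using has_integral_unique by (metis minus_zero)
  then show ?case using step.IH[OF le] by (simp del: of_nat_Suc)
qed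

lemma bspline_integral:
  assumes "0 < h" "1 \<le> m" "- int m \<le> j" "knot h (j + int m + 1) \<le> L"
  shows "integral {0..L} (bspline h m j) = (knot h (j + int m + 1) - knot h j) / real (m + 1)"
proof -
  obtain k where k: "m = Suc k" using assms(2) by (cases m) auto
  have "bspline h m j = (\<lambda>t. (knot h (j + int m + 1) - knot h j) * nspline h m j t)"
    using nspline_mult[OF assms(1)] by simp
  then show ?thesis using nspline_integral[of h k j L] assms k by simp
qed

section \<open>Spline sums: partition of unity, linear precision, translation\<close>

text \<open>One step of de Boor's algorithm: the degree drops by one and the coefficients become
  dependent on \<open>t\<close>. Of the surplus terms at the ends, the lower one vanishes by its
  index, the upper one because \<open>t < knot h (N + 1)\<close>.\<close>

lemma bspline_sum_rec:
  assumes h: "0 < h" and t: "t < knot h (N + 1)" and N: "0 \<le> N"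
  shows "(\<Sum>i=- int (Suc k)..N. c i * bspline h (Suc k) i t) =
    (\<Sum>i=- int k..N. (c i * (t - knot h i) + c (i - 1) * (knot h (i + int k + 1) - t)) * nspline h k i t)"
proof -
  let ?g = "\<lambda>i. c (i - 1) * (knot h (i + int k + 1) - t) * nspline h k i t"
  have "(\<Sum>i=- int (Suc k)..N. c i * bspline h (Suc k) i t)
      = (\<Sum>i=- int (Suc k)..N. c i * (t - knot h i) * nspline h k i t)
      + (\<Sum>i=- int (Suc k)..N. ?g (i + 1))"
    unfolding sum.distrib[symmetric] bspline_rec by (intro sum.cong) (auto simp: algebra_simps)
  also have "(\<Sum>i=- int (Suc k)..N. c i * (t - knot h i) * nspline h k i t)
      = (\<Sum>i=- int k..N. c i * (t - knot h i) * nspline h k i t)"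
    by (rule sum.mono_neutral_right) (auto simp: nspline_index)
  also have "(\<Sum>i=- int (Suc k)..N. ?g (i + 1)) = (\<Sum>i=- int k..N + 1. ?g i)"
    by (rule sum.reindex_bij_witness[of _ "\<lambda>i. i - 1" "\<lambda>i. i + 1"]) auto
  also have "\<dots> = (\<Sum>i=- int k..N. ?g i)"
  proof (rule sum.mono_neutral_right)
    have "bspline h k (N + 1) t = 0" using t by (intro bspline_support[OF h]) auto
    then show "\<forall>i\<in>{- int k..N + 1} - {- int k..N}. ?g i = 0"
      by (auto simp: nspline_def not_le dest!: zless_imp_add1_zle intro: antisym)
  qed auto
  finally show ?thesis by (simp only: distrib_right sum.distrib)
qed

text \<open>With constant coefficients the new coefficients are the knot spans, which undo the
  normalisation, so the sum does not depend on the degree. In degree 0 only the cell containing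
  \<open>t\<close> contributes.\<close>

lemma bspline_partition:
  assumes h: "0 < h" and t: "0 \<le> t" "t < knot h (N + 1)" and N: "0 \<le> N"
  shows "(\<Sum>i=- int k..N. bspline h k i t) = 1"
proof (induction k)
  case 0
  define l where "l = \<lfloor>t / h\<rfloor>"
  have l: "0 \<le> l" "real_of_int l * h \<le> t" "t < real_of_int (l + 1) * h"
    using t h unfolding l_def
    by (simp_all add: pos_le_divide_eq[symmetric] pos_divide_less_eq[symmetric])
  have iff: "knot h i \<le> t \<and> t < knot h (i + 1) \<longleftrightarrow> i = l" if "0 \<le> i" for i
  proof
    assume a: "knot h i \<le> t \<and> t < knot h (i + 1)"
    then have "real_of_int i * h < real_of_int (l + 1) * h" "real_of_int l * h < real_of_int (i + 1) * h"
      using l that by (auto simp: knot_def)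
    then show "i = l" using h by (auto simp: mult_less_cancel_right)
  qed (use l that in \<open>auto simp: knot_def\<close>)
  have "real_of_int l * h < real_of_int (N + 1) * h" using l t N by (simp add: knot_def)
  then have "l \<le> N" using h by (auto simp: mult_less_cancel_right)
  have "(\<Sum>i=0..N. bspline h 0 i t) = (\<Sum>i\<in>{l}. bspline h 0 i t)"
    using l \<open>l \<le> N\<close> iff by (intro sum.mono_neutral_right) auto
  then show ?case using iff[of l] l by simp
next
  case (Suc k)
  have "(\<Sum>i=- int (Suc k)..N. 1 * bspline h (Suc k) i t)
      = (\<Sum>i=- int k..N. (knot h (i + int k + 1) - knot h i) * nspline h k i t)"
    unfolding bspline_sum_rec[OF h t(2) N] by simp
  then show ?case using Suc nspline_mult[OF h] by simp
qed

text \<open>Marsden's identity for linear functions; the coefficients are \<open>k\<close> times the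
  Greville points. Each raise of the degree adds \<open>t\<close> times the partition of
  unity.\<close>

lemma marsden_linear:
  assumes h: "0 < h" and t: "0 \<le> t" "t < knot h (N + 1)" and N: "0 \<le> N"
  shows "(\<Sum>i=- int k..N. (\<Sum>l=1..k. knot h (i + int l)) * bspline h k i t) = real k * t"
proof (induction k)
  case 0
  then show ?case by simp
next
  case (Suc k)
  let ?c = "\<lambda>k i. \<Sum>l=1..k. knot h (i + int l)"
  have c: "?c (Suc k) (i - 1) = knot h i + ?c k i" for i
    by (subst sum.atLeast_Suc_atMost, simp)
      (simp add: sum.shift_bounds_cl_Suc_ivl algebra_simps del: sum.cl_ivl_Suc)
  have "(?c (Suc k) i * (t - knot h i) + ?c (Suc k) (i - 1) * (knot h (i + int k + 1) - t)) * nspline h k i t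
      = ?c k i * bspline h k i t + t * bspline h k i t" for i
  proof -
    have "?c (Suc k) i = ?c k i + knot h (i + int k + 1)" by (simp add: algebra_simps)
    then have "?c (Suc k) i * (t - knot h i) + ?c (Suc k) (i - 1) * (knot h (i + int k + 1) - t)
      = (?c k i + t) * (knot h (i + int k + 1) - knot h i)"
      unfolding c by (simp add: algebra_simps)
    then show ?thesis
      using nspline_mult[OF h, of i k t] by (metis distrib_right mult.assoc)
  qed
  then have "(\<Sum>i=- int (Suc k)..N. ?c (Suc k) i * bspline h (Suc k) i t)
     = (\<Sum>i=- int k..N. ?c k i * bspline h k i t) + t * (\<Sum>i=- int k..N. bspline h k i t)"
    unfolding bspline_sum_rec[OF h t(2) N] by (simp add: sum.distrib sum_distrib_left del: sum.cl_ivl_Suc)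
  then show ?case
    using Suc bspline_partition[OF h t N] by (simp add: algebra_simps del: sum.cl_ivl_Suc)
qed

text \<open>From index 0 on all knots involved are equally spaced, so the recursion commutes with
  translation by \<open>h\<close>.\<close>

lemma bspline_shift:
  assumes "0 \<le> j"
  shows "bspline h k (j + 1) t = bspline h k j (t - h)"
  using assms
proof (induction k arbitrary: j)
  case 0
  have "knot h (i + 1) = knot h i + h" if "0 \<le> i" for i
    using that by (simp add: knot_def algebra_simps)
  from this[of j] this[of "j + 1"] show ?case using 0 by auto
next
  case (Suc k)
  have kn: "knot h (i + 1) = knot h i + h" if "0 \<le> i" for i
    using that by (simp add: knot_def algebra_simps)
  have e: "j + 1 + int k + 1 = (j + int k + 1) + 1" "j + 1 + 1 + int k + 1 = (j + 1 + int k + 1) + 1"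
      "j + 1 + int k + 2 = (j + int k + 2) + 1" by simp_all
  have "nspline h k (i + 1) t = nspline h k i (t - h)" if "0 \<le> i" for i
  proof -
    have "i + 1 + int k + 1 = (i + int k + 1) + 1" by simp
    then show ?thesis unfolding nspline_def using that Suc.IH[of i] kn[of i] kn[of "i + int k + 1"]
      by simp
  qed
  from this[of j] this[of "j + 1"] show ?case
    unfolding bspline_rec e(3) using kn[of j] kn[of "j + int k + 2"] Suc.prems
    by (simp add: algebra_simps)
qed

section \<open>Regularity of the solution\<close>

text \<open>Used to continue a kernel to the left of 0 and to extend the solution by zero. At
  \<open>b\<close> the one-sided derivatives agree; elsewhere one of the two filters is
  trivial.\<close>

lemma has_field_derivative_within_glue:
  fixes f g :: "real \<Rightarrow> real"
  assumes A: "\<And>x. x \<in> {a..b} \<Longrightarrow> (f has_real_derivative f' x) (at x within {a..b})"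
    and B: "\<And>x. x \<in> {b..c} \<Longrightarrow> (g has_real_derivative g' x) (at x within {b..c})"
    and eq: "f b = g b" "f' b = g' b" and x: "x \<in> {a..c}" and ab: "a \<le> b" "b \<le> c"
  shows "((\<lambda>x. if x < b then f x else g x) has_real_derivative (if x < b then f' x else g' x))
           (at x within {a..c})"
proof -
  let ?F = "\<lambda>x. if x < b then f x else g x" and ?F' = "if x < b then f' x else g' x"
  have "(?F has_real_derivative ?F') (at x within {a..b})"
  proof (cases "x \<le> b")
    case True
    have "(f has_real_derivative ?F') (at x within {a..b})"
      using A[of x] x True eq by (auto simp: not_less dest: antisym)
    then show ?thesis
      by (rule has_field_derivative_transform_within[OF _ zero_less_one]) (use x True eq in auto)
  next
    case False
    then have "at x within {a..b} = bot"
      by (metis atLeastAtMost_iff closed_atLeastAtMost closed_limpt trivial_limit_within)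
    then show ?thesis by simp
  qed
  moreover have "(?F has_real_derivative ?F') (at x within {b..c})"
  proof (cases "b \<le> x")
    case True
    have "(g has_real_derivative ?F') (at x within {b..c})"
      using B[of x] x True by auto
    then show ?thesis
      by (rule has_field_derivative_transform_within[OF _ zero_less_one]) (use x True in auto)
  next
    case False
    then have "at x within {b..c} = bot"
      by (metis atLeastAtMost_iff closed_atLeastAtMost closed_limpt trivial_limit_within)
    then show ?thesis by simp
  qed
  ultimately have "(?F has_real_derivative ?F') (at x within {a..b} \<union> {b..c})"
    unfolding has_field_derivative_iff by (simp add: Lim_within_Un)
  moreover have "{a..b} \<union> {b..c} = {a..c}" using ab by auto
  ultimately show ?thesis by simp
qed

lemma DERIV_shift_within:
  assumes "(g has_real_derivative D) (at (x - c) within S)" "(\<lambda>x. x - c) ` A \<subseteq> S"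
  shows "((\<lambda>x. g (x - c)) has_real_derivative D) (at x within A)"
proof -
  have "(g has_real_derivative D) (at (x - c) within (\<lambda>x. x - c) ` A)"
    by (rule DERIV_subset[OF assms])
  moreover have "((\<lambda>x. x - c) has_real_derivative 1) (at x within A)"
    by (auto intro!: derivative_eq_intros)
  ultimately show ?thesis using DERIV_image_chain by (fastforce simp: o_def)
qed

lemma continuous_on_Icc_abs_bound:
  fixes f :: "real \<Rightarrow> real"
  assumes "continuous_on {a..b} f"
  shows "\<exists>B. \<forall>t\<in>{a..b}. \<bar>f t\<bar> \<le> B"
proof -
  have "bounded (f ` {a..b})"
    using assms by (intro compact_imp_bounded compact_continuous_image) auto
  then show ?thesis unfolding bounded_iff by auto
qed

text \<open>Leibniz rule with \<open>t\<close> both in the kernel and in the limit of integration.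
  The two roles are separated in \<open>H x y\<close>, which is differentiated in two variables and
  then restricted to the diagonal.\<close>

lemma convolution_has_derivative:
  fixes k k' u :: "real \<Rightarrow> real"
  assumes T: "0 < T" and u: "continuous_on {0..T} u"
    and k: "\<And>x. x \<in> {0..T} \<Longrightarrow> (k has_real_derivative k' x) (at x within {0..T})"
    and k': "continuous_on {0..T} k'" and t: "t \<in> {0..T}"
  shows "((\<lambda>t. integral {0..t} (\<lambda>s. k (t - s) * u s)) has_real_derivative
           k 0 * u t + integral {0..t} (\<lambda>s. k' (t - s) * u s)) (at t within {0..T})"
proof -
  \<comment> \<open>For \<open>y > x\<close> the integrand of \<open>H x y\<close> needs the kernel
    at negative arguments; a linear continuation keeps its derivative continuous. On the diagonal it
    is not seen.\<close>
  define g where "g x = (if x < 0 then k 0 + k' 0 * x else k x)" for x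
  define g' where "g' x = (if x < 0 then k' 0 else k' x)" for x
  have g: "(g has_real_derivative g' x) (at x within {-T..T})" if "x \<in> {-T..T}" for x
    unfolding g_def[abs_def] g'_def
    by (rule has_field_derivative_within_glue) (use that T in \<open>auto intro!: k derivative_eq_intros\<close>)
  have "continuous_on ({-T..0} \<union> {0..T}) (\<lambda>x. if x \<le> 0 then k' 0 else k' x)"
    using k' by (intro continuous_on_cases) auto
  moreover have "{-T..0} \<union> {0..T} = {-T..T}" using T by auto
  moreover have "(\<lambda>x. if x \<le> 0 then k' 0 else k' x) = g'" by (auto simp: g'_def)
  ultimately have g': "continuous_on {-T..T} g'" by metis
  have gc: "continuous_on {-T..T} g"
    using g by (meson DERIV_continuous continuous_on_eq_continuous_within)
  define H where "H x y = integral {0..y} (\<lambda>s. g (x - s) * u s)" for x y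
  have "((\<lambda>x. integral (cbox 0 t) (\<lambda>s. g (x - s) * u s)) has_real_derivative
      integral (cbox 0 t) (\<lambda>s. g' (t - s) * u s)) (at t within {0..T})"
  proof (rule leibniz_rule_field_derivative)
    fix x s assume xs: "x \<in> {0..T}" "s \<in> cbox 0 t"
    then have m: "x - s \<in> {-T..T}" using t by (auto simp: cbox_interval)
    have "((\<lambda>x. g (x - s)) has_real_derivative g' (x - s)) (at x within {0..T})"
      using xs t by (intro DERIV_shift_within[OF g[OF m]]) (auto simp: cbox_interval)
    then show "((\<lambda>x. g (x - s) * u s) has_real_derivative g' (x - s) * u s) (at x within {0..T})"
      by (rule DERIV_cmult_right)
  next
    fix x assume "x \<in> {0..T}"
    then show "(\<lambda>s. g (x - s) * u s) integrable_on cbox 0 t"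
      using t unfolding cbox_interval
      by (intro integrable_continuous_interval continuous_intros continuous_on_subset[OF u]
          continuous_on_compose2[OF gc]) auto
  next
    show "continuous_on ({0..T} \<times> cbox 0 t) (\<lambda>(x, s). g' (x - s) * u s)"
      using t unfolding cbox_interval case_prod_beta
      by (intro continuous_intros continuous_on_compose2[OF u] continuous_on_compose2[OF g']) auto
  qed (use t in auto)
  then have dx: "((\<lambda>x. H x t) has_derivative (*) (integral {0..t} (\<lambda>s. g' (t - s) * u s)))
      (at t within {0..T})"
    unfolding H_def has_field_derivative_def cbox_interval .
  have dy: "((\<lambda>y. H x y) has_derivative blinfun_apply (blinfun_scaleR_left (g (x - y) * u y)))
      (at y within {0..T})" if "x \<in> {0..T}" "y \<in> {0..T}" for x y
  proof -
    have "continuous_on {0..T} (\<lambda>s. g (x - s) * u s)"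
      using that by (intro continuous_intros continuous_on_subset[OF u] continuous_on_compose2[OF gc]) auto
    from integral_has_real_derivative[OF this that(2)] show ?thesis
      unfolding H_def has_field_derivative_def by (simp add: mult.commute[of "g (x - y) * u y"])
        (simp add: mult_commute_abs)
  qed
  \<comment> \<open>For total differentiability it is the partial derivative in \<open>y\<close>
    that has to be jointly continuous.\<close>
  have "((\<lambda>(x, y). H x y) has_derivative
      (\<lambda>(tx, ty). integral {0..t} (\<lambda>s. g' (t - s) * u s) * tx
         + blinfun_scaleR_left (g (t - t) * u t) ty)) (at (t, t) within {0..T} \<times> {0..T})"
  proof (rule has_derivative_partialsI[OF dx dy])
    have "continuous_on ({0..T} \<times> {0..T}) (\<lambda>(x, y). blinfun_scaleR_left (g (x - y) * u y))"
      unfolding case_prod_beta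
      by (intro continuous_intros continuous_on_compose2[OF u] continuous_on_compose2[OF gc]
          bounded_linear.continuous_on[OF bounded_linear_blinfun_scaleR_left]) auto
    then show "continuous (at (t, t) within {0..T} \<times> {0..T}) (\<lambda>(x, y). blinfun_scaleR_left (g (x - y) * u y))"
      using t by (auto simp: continuous_on_eq_continuous_within)
  qed (use t in auto)
  then have "((\<lambda>(x, y). H x y) has_derivative
      (\<lambda>(tx, ty). integral {0..t} (\<lambda>s. g' (t - s) * u s) * tx
         + blinfun_scaleR_left (g (t - t) * u t) ty)) (at (t, t) within (\<lambda>x. (x, x)) ` {0..T})"
    by (rule has_derivative_subset) auto
  moreover have "((\<lambda>x. (x, x)) has_derivative (\<lambda>x. (x, x))) (at t within {0..T})"
    by (auto intro!: derivative_eq_intros)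
  ultimately have "((\<lambda>(x, y). H x y) \<circ> (\<lambda>x. (x, x)) has_derivative
      (\<lambda>(tx, ty). integral {0..t} (\<lambda>s. g' (t - s) * u s) * tx
         + blinfun_scaleR_left (g (t - t) * u t) ty) \<circ> (\<lambda>x. (x, x))) (at t within {0..T})"
    by (intro diff_chain_within)
  moreover have derivative: "(\<lambda>x. x * (g 0 * u t) + integral {0..t} (\<lambda>s. g' (t - s) * u s) * x)
      = (*) (g 0 * u t + integral {0..t} (\<lambda>s. g' (t - s) * u s))"
    by (auto simp: fun_eq_iff algebra_simps)
  ultimately have "((\<lambda>x. H x x) has_real_derivative
      g 0 * u t + integral {0..t} (\<lambda>s. g' (t - s) * u s)) (at t within {0..T})"
    unfolding has_field_derivative_def o_def
    by (simp add: derivative add.commute)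
  moreover have "H x x = integral {0..x} (\<lambda>s. k (x - s) * u s)" for x
    unfolding H_def by (rule integral_cong) (simp add: g_def)
  moreover have "integral {0..t} (\<lambda>s. g' (t - s) * u s) = integral {0..t} (\<lambda>s. k' (t - s) * u s)"
    by (rule integral_cong) (simp add: g'_def)
  ultimately show ?thesis by (simp add: g_def)
qed

section \<open>Derivatives of the Volterra solution\<close>

lemma C_k_on_deriv:
  assumes "C_k_on k f {0..T}" "i < k" "t \<in> {0..T}"
  shows "(deriv_within {0..T} i f has_real_derivative deriv_within {0..T} (Suc i) f t) (at t within {0..T})"
  using assms unfolding C_k_on_def differentiable_on_def
  by (auto simp: has_real_derivative_iff_has_vector_derivative vector_derivative_works[symmetric])

lemma has_real_derivative_unique_interval:
  assumes "0 < (T::real)" "t \<in> {0..T}"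
    and "(f has_real_derivative x) (at t within {0..T})" "(f has_real_derivative y) (at t within {0..T})"
  shows "x = y"
  using vector_derivative_unique_within_closed_interval[of 0 T t f x y] assms
  by (simp add: has_real_derivative_iff_has_vector_derivative cbox_interval)

text \<open>Since \<open>K 0 = 1\<close>, differentiating once gives an equation of the second kind
  that expresses \<open>u\<close> by the derivative of \<open>a\<close> and a convolution of
  \<open>u\<close>. Five derivatives of the data thus yield four of \<open>u\<close>. At 0 the
  convolutions are integrals over a point and the derivatives of \<open>a\<close> vanish, hence so
  do those of \<open>u\<close>.\<close>

lemma volterra_regularity:
  fixes a K u :: "real \<Rightarrow> real"
  assumes T: "0 < T" and a: "C_k_on 5 a {0..T}" and K: "C_k_on 5 K {0..T}" and K0: "K 0 = 1"
    and a0: "\<forall>p\<le>5. deriv_within {0..T} p a 0 = 0" and u: "volterra_solution K a T u"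
  obtains U :: "nat \<Rightarrow> real \<Rightarrow> real" and B where
    "\<And>t. t \<in> {0..T} \<Longrightarrow> U 0 t = u t"
    "\<And>i. i \<le> 4 \<Longrightarrow> U i 0 = 0"
    "\<And>i t. i < 4 \<Longrightarrow> t \<in> {0..T} \<Longrightarrow> (U i has_real_derivative U (Suc i) t) (at t within {0..T})"
    "\<And>i t. i \<le> 4 \<Longrightarrow> t \<in> {0..T} \<Longrightarrow> \<bar>U i t\<bar> \<le> B"
proof -
  let ?A = "\<lambda>i. deriv_within {0..T} i a" and ?K = "\<lambda>i. deriv_within {0..T} i K"
  have dA: "(?A i has_real_derivative ?A (Suc i) t) (at t within {0..T})"
    and dK: "(?K i has_real_derivative ?K (Suc i) t) (at t within {0..T})"
    if "i < 5" "t \<in> {0..T}" for i t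
    using C_k_on_deriv[OF a] C_k_on_deriv[OF K] that by blast+
  have cA: "continuous_on {0..T} (?A i)" and cK: "continuous_on {0..T} (?K i)" if "i \<le> 5" for i
    using that a K by (auto simp: C_k_on_def)
  have cu: "continuous_on {0..T} u" using u by (simp add: volterra_solution_def)
  define c where "c i t = integral {0..t} (\<lambda>s. ?K i (t - s) * u s)" for i t
  have dc: "(c i has_real_derivative ?K i 0 * u t + c (Suc i) t) (at t within {0..T})"
    if "i < 5" "t \<in> {0..T}" for i t
    unfolding c_def[abs_def] 
    by (rule convolution_has_derivative[OF T cu dK[OF that(1)] cK that(2)]) (use that in auto)
  \<comment> \<open>The reflection of \<open>s\<close> in the interval moves the shift onto the
    kernel, the factor known to be differentiable.\<close>
  have refl: "integral {0..t} (\<lambda>s. K s * u (t - s)) = c 0 t" if "t \<in> {0..T}" for t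
  proof -
    have "(\<lambda>s. K s * u (t - s)) integrable_on {0..t}"
      using that cK[of 0]
      by (intro integrable_continuous_interval continuous_intros continuous_on_compose2[OF cu])
        (auto intro: continuous_on_subset)
    then have "((\<lambda>s. K s * u (t - s)) has_integral integral {0..t} (\<lambda>s. K s * u (t - s))) (cbox 0 t)"
      by (simp add: cbox_interval integrable_integral)
    from has_integral_affinity[OF this, of "- 1" t]
    show ?thesis unfolding c_def using that by (auto simp: cbox_interval dest!: integral_unique)
  qed
  have u_eq: "u t = ?A 1 t - c 1 t" if t: "t \<in> {0..T}" for t
  proof -
    have "(c 0 has_real_derivative ?A 1 t) (at t within {0..T})"
    proof (rule has_field_derivative_transform_within[OF _ zero_less_one t, of a])
      show "(a has_real_derivative ?A 1 t) (at t within {0..T})"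
        using dA[of 0 t] t unfolding deriv_within.simps(1) One_nat_def by simp
      show "a x = c 0 x" if "x \<in> {0..T}" for x
        using refl[OF that] u that unfolding volterra_solution_def by metis
    qed
    from has_real_derivative_unique_interval[OF T t this dc[of 0 t]] show ?thesis
      using t K0 by simp
  qed
  \<comment> \<open>\<open>U1\<close> to \<open>U4\<close> are the successive derivatives of
    \<open>U0\<close>: by \<open>dc\<close>, differentiating \<open>c i\<close> produces the
    boundary term \<open>?K i 0 * u t\<close> and raises \<open>i\<close>.\<close>
  define U0 where "U0 t = ?A 1 t - c 1 t" for t
  define U1 where "U1 t = ?A 2 t - ?K 1 0 * U0 t - c 2 t" for t
  define U2 where "U2 t = ?A 3 t - ?K 1 0 * U1 t - ?K 2 0 * U0 t - c 3 t" for t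
  define U3 where "U3 t = ?A 4 t - ?K 1 0 * U2 t - ?K 2 0 * U1 t - ?K 3 0 * U0 t - c 4 t" for t
  define U4 where "U4 t = ?A 5 t - ?K 1 0 * U3 t - ?K 2 0 * U2 t - ?K 3 0 * U1 t - ?K 4 0 * U0 t - c 5 t" for t
  have u0: "u t = U0 t" if "t \<in> {0..T}" for t
    unfolding U0_def by (rule u_eq[OF that])
  have dA': "(?A i has_real_derivative ?A j t) (at t within {0..T})"
    and dc': "(c i has_real_derivative ?K i 0 * U0 t + c j t) (at t within {0..T})"
    if "j = Suc i" "i < 5" "t \<in> {0..T}" for i j t
    using dA[of i t] dc[of i t] that u0 by auto
  have d0: "(U0 has_real_derivative U1 t) (at t within {0..T})" if "t \<in> {0..T}" for t
    unfolding U0_def[abs_def] U1_def using that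
    by (auto intro!: derivative_eq_intros dA'[of 2] dc'[of 2] simp: U0_def simp del: deriv_within.simps)
  have d1: "(U1 has_real_derivative U2 t) (at t within {0..T})" if "t \<in> {0..T}" for t
    unfolding U1_def[abs_def] U2_def using that
    by (auto intro!: derivative_eq_intros d0 dA'[of 3] dc'[of 3] simp: U1_def simp del: deriv_within.simps)
  have d2: "(U2 has_real_derivative U3 t) (at t within {0..T})" if "t \<in> {0..T}" for t
    unfolding U2_def[abs_def] U3_def using that
    by (auto intro!: derivative_eq_intros d0 d1 dA'[of 4] dc'[of 4] simp: U2_def simp del: deriv_within.simps)
  have d3: "(U3 has_real_derivative U4 t) (at t within {0..T})" if "t \<in> {0..T}" for t
    unfolding U3_def[abs_def] U4_def using that
    by (auto intro!: derivative_eq_intros d0 d1 d2 dA'[of 5] dc'[of 5] simp: U3_def simp del: deriv_within.simps)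
  have dcont: "continuous_on {0..T} f" if "\<And>t. t \<in> {0..T} \<Longrightarrow> (f has_real_derivative f' t) (at t within {0..T})"
    for f f' :: "real \<Rightarrow> real"
    using that by (meson DERIV_continuous continuous_on_eq_continuous_within)
  obtain B0 where B0: "\<And>t. t \<in> {0..T} \<Longrightarrow> \<bar>U0 t\<bar> \<le> B0" using continuous_on_Icc_abs_bound[OF dcont[OF d0]] by blast
  obtain B1 where B1: "\<And>t. t \<in> {0..T} \<Longrightarrow> \<bar>U1 t\<bar> \<le> B1" using continuous_on_Icc_abs_bound[OF dcont[OF d1]] by blast
  obtain B2 where B2: "\<And>t. t \<in> {0..T} \<Longrightarrow> \<bar>U2 t\<bar> \<le> B2" using continuous_on_Icc_abs_bound[OF dcont[OF d2]] by blast
  obtain B3 where B3: "\<And>t. t \<in> {0..T} \<Longrightarrow> \<bar>U3 t\<bar> \<le> B3" using continuous_on_Icc_abs_bound[OF dcont[OF d3]] by blast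
  obtain BA where BA: "\<And>t. t \<in> {0..T} \<Longrightarrow> \<bar>?A 5 t\<bar> \<le> BA" using continuous_on_Icc_abs_bound[OF cA[OF order_refl]] by blast
  obtain BK where BK: "\<And>t. t \<in> {0..T} \<Longrightarrow> \<bar>?K 5 t\<bar> \<le> BK" using continuous_on_Icc_abs_bound[OF cK[OF order_refl]] by blast
  have c5: "\<bar>c 5 t\<bar> \<le> BK * B0 * T" if t: "t \<in> {0..T}" for t
  proof -
    have nn: "0 \<le> BK * B0" using BK[of 0] B0[of 0] T by force
    have "norm (integral {0..t} (\<lambda>s. ?K 5 (t - s) * u s)) \<le> BK * B0 * (t - 0)"
    proof (rule integral_bound)
      show "continuous_on {0..t} (\<lambda>s. ?K 5 (t - s) * u s)"
        using t by (intro continuous_intros continuous_on_compose2[OF cK[of 5]] continuous_on_subset[OF cu]) auto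
      show "norm (?K 5 (t - s) * u s) \<le> BK * B0" if "s \<in> {0..t}" for s
        using BK[of "t - s"] B0[of s] u0[of s] t that by (auto simp: abs_mult intro!: mult_mono)
    qed (use t in auto)
    also have "\<dots> \<le> BK * B0 * T" using nn t by (intro mult_left_mono) auto
    finally show ?thesis by (simp add: c_def)
  qed
  have "\<bar>U4 t\<bar> \<le> BA + \<bar>?K 1 0\<bar> * B3 + \<bar>?K 2 0\<bar> * B2 + \<bar>?K 3 0\<bar> * B1 + \<bar>?K 4 0\<bar> * B0 + BK * B0 * T"
    if t: "t \<in> {0..T}" for t
  proof -
    have m: "\<bar>x * y\<bar> \<le> \<bar>x\<bar> * z" if "\<bar>y\<bar> \<le> z" for x y z :: real
      using that by (simp add: abs_mult mult_left_mono)
    have sum6: "\<bar>x1 - x2 - x3 - x4 - x5 - x6\<bar> \<le> y1 + y2 + y3 + y4 + y5 + y6"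
      if "\<bar>x1\<bar> \<le> y1" "\<bar>x2\<bar> \<le> y2" "\<bar>x3\<bar> \<le> y3" "\<bar>x4\<bar> \<le> y4" "\<bar>x5\<bar> \<le> y5" "\<bar>x6\<bar> \<le> y6"
      for x1 x2 x3 x4 x5 x6 y1 y2 y3 y4 y5 y6 :: real
      using that by linarith
    show ?thesis
      unfolding U4_def by (intro sum6 BA c5 m B0 B1 B2 B3 t)
  qed
  then obtain B4 where B4: "\<And>t. t \<in> {0..T} \<Longrightarrow> \<bar>U4 t\<bar> \<le> B4" by blast
  define U where "U i = (if i = 0 then U0 else if i = 1 then U1 else if i = 2 then U2
     else if i = 3 then U3 else U4)" for i :: nat
  have le4: "i \<in> {0, 1, 2, 3, 4}" if "i \<le> 4" for i :: nat using that by auto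
  have lt4: "i \<in> {0, 1, 2, 3}" if "i < 4" for i :: nat using that by auto
  show ?thesis
  proof (rule that[of U "B0 + B1 + B2 + B3 + B4"])
    have c0: "c i 0 = 0" for i by (simp add: c_def)
    have A0: "?A i 0 = 0" if "i \<le> 5" for i using a0 that by simp
    show "U i 0 = 0" if "i \<le> 4" for i
      using le4[OF that] A0[of 1] A0[of 2] A0[of 3] A0[of 4] A0[of 5]
      by (auto simp: U_def U0_def U1_def U2_def U3_def U4_def c0 simp del: deriv_within.simps)
    show "(U i has_real_derivative U (Suc i) t) (at t within {0..T})" if "i < 4" "t \<in> {0..T}" for i t
      using lt4[OF that(1)] d0 d1 d2 d3 that(2) by (auto simp: U_def)
    show "\<bar>U i t\<bar> \<le> B0 + B1 + B2 + B3 + B4" if "i \<le> 4" "t \<in> {0..T}" for i t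
    proof -
      have "U i t \<in> {U0 t, U1 t, U2 t, U3 t, U4 t}" by (simp add: U_def)
      then show ?thesis
        using B0[OF that(2)] B1[OF that(2)] B2[OF that(2)] B3[OF that(2)] B4[OF that(2)]
        by (elim insertE emptyE) linarith+
    qed
  qed (use u0 in \<open>auto simp: U_def\<close>)
qed

text \<open>The extension by zero keeps four derivatives because all of them vanish at 0.\<close>

lemma zero_ext_regularity:
  fixes a K u :: "real \<Rightarrow> real"
  assumes T: "0 < T" and a: "C_k_on 5 a {0..T}" and K: "C_k_on 5 K {0..T}" and K0: "K 0 = 1"
    and a0: "\<forall>p\<le>5. deriv_within {0..T} p a 0 = 0" and u: "volterra_solution K a T u"
  obtains U :: "nat \<Rightarrow> real \<Rightarrow> real" and B where
    "\<And>t. t \<le> T \<Longrightarrow> U 0 t = zero_ext u t"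
    "\<And>i t. i \<le> 4 \<Longrightarrow> t \<le> 0 \<Longrightarrow> U i t = 0"
    "\<And>i t. i < 4 \<Longrightarrow> t \<le> T \<Longrightarrow> (U i has_real_derivative U (Suc i) t) (at t within {..T})"
    "\<And>i t. i \<le> 4 \<Longrightarrow> t \<le> T \<Longrightarrow> \<bar>U i t\<bar> \<le> B"
proof -
  obtain V B where V: "\<And>t. t \<in> {0..T} \<Longrightarrow> V 0 t = u t"
      "\<And>i. i \<le> 4 \<Longrightarrow> V i 0 = 0"
      "\<And>i t. i < 4 \<Longrightarrow> t \<in> {0..T} \<Longrightarrow> (V i has_real_derivative V (Suc i) t) (at t within {0..T})"
      "\<And>i t. i \<le> 4 \<Longrightarrow> t \<in> {0..T} \<Longrightarrow> \<bar>V i t\<bar> \<le> B"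
    by (rule volterra_regularity[OF assms]) blast
  define U where "U i t = (if t < 0 then 0 else V i t)" for i t
  show ?thesis
  proof (rule that[of U B])
    show "U 0 t = zero_ext u t" if "t \<le> T" for t
      using that V(1)[of t] by (simp add: U_def zero_ext_def)
    show "U i t = 0" if "i \<le> 4" "t \<le> 0" for i t
      using that V(2)[of i] by (cases "t = 0") (auto simp: U_def)
    show "\<bar>U i t\<bar> \<le> B" if "i \<le> 4" "t \<le> T" for i t
      using that V(4)[of i t] V(4)[of i 0] T by (auto simp: U_def)
    show "(U i has_real_derivative U (Suc i) t) (at t within {..T})" if i: "i < 4" and t: "t \<le> T" for i t
    proof -
      \<comment> \<open>A derivative within a set is a local notion, so the half-line may be cut off
        at any point to the left of \<open>t\<close> and 0.\<close>
      define R where "R = \<bar>t\<bar> + 1"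
      have "(U i has_real_derivative U (Suc i) t) (at t within {- R..T})"
        unfolding U_def[abs_def]
        by (rule has_field_derivative_within_glue) (use i t T V in \<open>auto simp: R_def\<close>)
      moreover have "at t within {- R..T} = at t within {..T}"
        by (rule at_within_nhd[of t "{- R<..}"]) (auto simp: R_def)
      ultimately show ?thesis by simp
    qed
  qed
qed

section \<open>Quasi-interpolation\<close>

text \<open>First order expansion of \<open>f (s + (real m - 1) * h / 2)\<close>, the value at the
  Greville point. The derivative avoids arguments beyond \<open>T\<close> and keeps the coefficient
  0 wherever \<open>f\<close> and \<open>f'\<close> vanish.\<close>

definition quasi_interpolant ::
  "(real \<Rightarrow> real) \<Rightarrow> (real \<Rightarrow> real) \<Rightarrow> nat \<Rightarrow> real \<Rightarrow> real \<Rightarrow> real" where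
  "quasi_interpolant f f' m h s = f s + (real m - 1) * h / 2 * f' s"

text \<open>\<open>M\<close> is free so that the splines can be made to sum to 1 at
  \<open>t\<close>; for functions that vanish on the negative axis, together with \<open>f'\<close>,
  terms with \<open>s \<le> real j * h\<close> contribute 0 if both vanish at 0 too.\<close>

definition quasi_error ::
  "(real \<Rightarrow> real) \<Rightarrow> (real \<Rightarrow> real) \<Rightarrow> nat \<Rightarrow> real \<Rightarrow> nat \<Rightarrow> real \<Rightarrow> real \<Rightarrow> real" where
  "quasi_error f f' m h M s t = f (s - t)
     - (\<Sum>j<M. quasi_interpolant f f' m h (s - real j * h) * bspline h m (int j - int m) t)"

lemma sum_int_shift:
  "(\<Sum>j<N + m. g (int j - int m)) = (\<Sum>i=- int m..int N - 1. g i)"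
  by (rule sum.reindex_bij_witness[of _ "\<lambda>i. nat (i + int m)" "\<lambda>j. int j - int m"]) auto

lemma bspline_sum_1:
  assumes "0 < h" "0 \<le> t" "t < real N * h"
  shows "(\<Sum>j<N + m. bspline h m (int j - int m) t) = 1"
proof -
  have "0 < real N * h" using assms by linarith
  then have N: "1 \<le> N" using assms(1) by (cases N) auto
  have "(\<Sum>j<N + m. bspline h m (int j - int m) t) = (\<Sum>i=- int m..int N - 1. bspline h m i t)"
    by (rule sum_int_shift)
  also have "\<dots> = 1"
    using assms N by (intro bspline_partition) (auto simp: knot_def)
  finally show ?thesis .
qed

text \<open>Linear precision with the Greville points in closed form. The form may fail for
  \<open>j < m\<close>, but those splines vanish for \<open>t\<close> beyond
  \<open>real m * h\<close>; for \<open>m = 1\<close> the average is the single knot of index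
  \<open>j\<close> and there is no exception.\<close>

lemma bspline_first_moment:
  assumes h: "0 < h" and t: "0 \<le> t" "t < real N * h" and m: "1 \<le> m"
    and "m = 1 \<or> real m * h \<le> t"
  shows "(\<Sum>j<N + m. (real j * h - (real m - 1) * h / 2) * bspline h m (int j - int m) t) = t"
proof -
  have "0 < real N * h" using t by linarith
  then have N: "1 \<le> N" using h by (cases N) auto
  let ?c = "\<lambda>i. \<Sum>l=1..m. knot h (i + int l)"
  have summand: "(real j * h - (real m - 1) * h / 2) * bspline h m (int j - int m) t
      = ?c (int j - int m) * bspline h m (int j - int m) t / real m" for j
  proof (cases "m = 1 \<or> m \<le> j")
    case True
    have "?c (int j - int m) = (\<Sum>l=1..m. (real j - real m + real l) * h)"
      using True by (intro sum.cong) (auto simp: knot_def)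
    also have "\<dots> = (real m * (real j - real m) + (\<Sum>l=1..m. real l)) * h"
      by (simp add: sum_distrib_right[symmetric] sum.distrib)
    also have "(\<Sum>l=1..m. real l) = real m * (real m + 1) / 2"
      using double_gauss_sum_from_Suc_0[of m, where 'a=real] by simp
    finally have "?c (int j - int m) = real m * (real j * h - (real m - 1) * h / 2)"
      by (simp add: field_simps)
    then show ?thesis using m by simp
  next
    case False
    have "real (Suc j) * h \<le> real m * h"
      using False h by (intro mult_right_mono) auto
    then have "knot h (int j - int m + int m + 1) \<le> t"
      using False assms(5) by (simp add: knot_def add.commute)
    then show ?thesis using bspline_support[OF h] by simp
  qed
  have "(\<Sum>j<N + m. (real j * h - (real m - 1) * h / 2) * bspline h m (int j - int m) t)
      = (\<Sum>j<N + m. ?c (int j - int m) * bspline h m (int j - int m) t) / real m"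
    unfolding summand by (simp add: sum_divide_distrib)
  also have "(\<Sum>j<N + m. ?c (int j - int m) * bspline h m (int j - int m) t)
      = (\<Sum>i=- int m..int N - 1. ?c i * bspline h m i t)"
    by (rule sum_int_shift)
  also have "\<dots> = real m * t"
    using t h N by (intro marsden_linear) (auto simp: knot_def)
  finally show ?thesis using m by simp
qed

section \<open>Local error of the quasi-interpolant\<close>

lemma bspline_nonzero_imp:
  assumes h: "0 < h" and m: "1 \<le> m" and t: "0 \<le> t" and nz: "bspline h m (int j - int m) t \<noteq> 0"
  shows "\<bar>t - real j * h\<bar> \<le> real m * h"
proof -
  have *: "knot h (int j - int m) \<le> t" "t < knot h (int j - int m + int m + 1)"
    using bspline_support[OF h] nz by (meson not_le)+
  have "t < real j * h + h" using * by (simp add: knot_def algebra_simps)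
  moreover have "real j * h - real m * h \<le> t"
  proof (cases "m \<le> j")
    case True
    then show ?thesis using * by (simp add: knot_def algebra_simps)
  next
    case False
    then have "real j * h \<le> real m * h" using h by (intro mult_right_mono) auto
    then show ?thesis using t by linarith
  qed
  moreover have "h \<le> real m * h" using m h by simp
  ultimately show ?thesis by linarith
qed

text \<open>Mean value inequality for \<open>f z - z * f' x\<close> as a function of
  \<open>z\<close> between \<open>x\<close> and \<open>y\<close>.\<close>

lemma taylor_lipschitz:
  fixes f f' :: "real \<Rightarrow> real"
  assumes f: "\<And>x. x \<le> T \<Longrightarrow> (f has_real_derivative f' x) (at x within {..T})"
    and lip: "\<And>x y. x \<le> T \<Longrightarrow> y \<le> T \<Longrightarrow> \<bar>f' x - f' y\<bar> \<le> L * \<bar>x - y\<bar>"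
    and xy: "x \<le> T" "y \<le> T" and L: "0 \<le> L"
  shows "\<bar>f x - f y - (x - y) * f' x\<bar> \<le> L * \<bar>x - y\<bar>\<^sup>2"
proof -
  let ?S = "{min x y..max x y}"
  have "norm ((\<lambda>z. f z - z * f' x) x - (\<lambda>z. f z - z * f' x) y) \<le> (L * \<bar>x - y\<bar>) * norm (x - y)"
  proof (rule field_differentiable_bound[of ?S _ "\<lambda>z. f' z - f' x"])
    fix z assume z: "z \<in> ?S"
    then have zT: "z \<le> T" using xy by auto
    have "(f has_real_derivative f' z) (at z within ?S)"
      by (rule DERIV_subset[OF f[OF zT]]) (use xy in auto)
    then show "((\<lambda>z. f z - z * f' x) has_real_derivative f' z - f' x) (at z within ?S)"
      by (auto intro!: derivative_eq_intros)
    have "\<bar>f' z - f' x\<bar> \<le> L * \<bar>z - x\<bar>" by (rule lip[OF zT xy(1)])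
    also have "\<dots> \<le> L * \<bar>x - y\<bar>" using z L by (intro mult_left_mono) auto
    finally show "norm (f' z - f' x) \<le> L * \<bar>x - y\<bar>" by simp
  qed auto
  then show ?thesis by (simp add: power2_eq_square algebra_simps)
qed

text \<open>Expanding about \<open>s - t\<close> and using that the splines sum to 1 leaves second
  order remainders and \<open>f' (s - t)\<close> times a first moment. By linear precision the
  moment vanishes, except for \<open>m > 1\<close> in the layer \<open>t < real m * h\<close>, where
  it is of order \<open>h\<close>.\<close>

lemma quasi_error_bound:
  fixes f f' :: "real \<Rightarrow> real"
  assumes f: "\<And>x. x \<le> T \<Longrightarrow> (f has_real_derivative f' x) (at x within {..T})"
    and lip: "\<And>x y. x \<le> T \<Longrightarrow> y \<le> T \<Longrightarrow> \<bar>f' x - f' y\<bar> \<le> L * \<bar>x - y\<bar>"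
    and L: "0 \<le> L" and h: "0 < h" and m: "1 \<le> m" and s: "s \<le> T"
    and t: "0 \<le> t" "t < real N * h"
  shows "\<bar>quasi_error f f' m h (N + m) s t\<bar>
     \<le> (if m = 1 \<or> real m * h \<le> t then 0 else 2 * real m * h * \<bar>f' (s - t)\<bar>) + 2 * (real m)\<^sup>2 * L * h\<^sup>2"
proof -
  let ?b = "\<lambda>j. bspline h m (int j - int m) t"
  define c where "c = (real m - 1) * h / 2"
  have c: "0 \<le> c" "c \<le> real m * h" using m h by (auto simp: c_def field_simps)
  have b: "0 \<le> ?b j" for j by (rule bspline_nonneg[OF h])
  \<comment> \<open>What is left for index \<open>j\<close> after removing the linear part at
    \<open>s - t\<close>: a Taylor remainder of \<open>f\<close> plus \<open>c\<close> times an
    increment of \<open>f'\<close>, each at most \<open>L * (real m * h)\<^sup>2\<close> where the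
    spline is nonzero.\<close>
  define R where "R j = f (s - t) - f (s - real j * h) - c * f' (s - real j * h)
      - (real j * h - t - c) * f' (s - t)" for j
  have R: "\<bar>R j * ?b j\<bar> \<le> 2 * (real m)\<^sup>2 * L * h\<^sup>2 * ?b j" for j
  proof (cases "?b j = 0")
    case False
    let ?x = "s - t" and ?y = "s - real j * h"
    have "0 \<le> real j * h" using h by simp
    then have xy: "?x \<le> T" "?y \<le> T" using s t by linarith+
    have d: "\<bar>?x - ?y\<bar> \<le> real m * h" using bspline_nonzero_imp[OF h m t(1) False] by simp
    have "\<bar>f ?x - f ?y - (?x - ?y) * f' ?x\<bar> \<le> L * \<bar>?x - ?y\<bar>\<^sup>2"
      by (rule taylor_lipschitz[OF f lip xy L]) auto
    also have "\<dots> \<le> L * (real m * h)\<^sup>2" using d L by (intro mult_left_mono power_mono) auto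
    finally have 1: "\<bar>f ?x - f ?y - (?x - ?y) * f' ?x\<bar> \<le> L * (real m * h)\<^sup>2" .
    have "\<bar>c * (f' ?x - f' ?y)\<bar> \<le> (real m * h) * (L * (real m * h))"
      unfolding abs_mult
    proof (rule mult_mono)
      show "\<bar>f' ?x - f' ?y\<bar> \<le> L * (real m * h)"
        using lip[OF xy] mult_left_mono[OF d L] by linarith
    qed (use c in auto)
    moreover have "R j = (f ?x - f ?y - (?x - ?y) * f' ?x) + c * (f' ?x - f' ?y)"
      by (simp add: R_def algebra_simps)
    ultimately have "\<bar>R j\<bar> \<le> 2 * (real m)\<^sup>2 * L * h\<^sup>2"
      using 1 by (simp add: power2_eq_square algebra_simps)
    then show ?thesis using b[of j] by (simp add: abs_mult mult_right_mono)
  qed simp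
  have S1: "(\<Sum>j<N + m. ?b j) = 1" by (rule bspline_sum_1[OF h t])
  have "quasi_error f f' m h (N + m) s t
      = (\<Sum>j<N + m. f (s - t) * ?b j) - (\<Sum>j<N + m. (f (s - real j * h) + c * f' (s - real j * h)) * ?b j)"
    unfolding quasi_error_def quasi_interpolant_def c_def by (simp add: sum_distrib_left[symmetric] S1)
  also have "\<dots> = (\<Sum>j<N + m. R j * ?b j + f' (s - t) * ((real j * h - t - c) * ?b j))"
    unfolding sum_subtractf[symmetric] R_def by (intro sum.cong) (auto simp: algebra_simps)
  also have "\<dots> = (\<Sum>j<N + m. R j * ?b j) + f' (s - t) * (\<Sum>j<N + m. (real j * h - t - c) * ?b j)"
    by (simp add: sum.distrib sum_distrib_left)
  finally have E: "quasi_error f f' m h (N + m) s t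
      = (\<Sum>j<N + m. R j * ?b j) + f' (s - t) * (\<Sum>j<N + m. (real j * h - t - c) * ?b j)" .
  have "\<bar>\<Sum>j<N + m. R j * ?b j\<bar> \<le> (\<Sum>j<N + m. 2 * (real m)\<^sup>2 * L * h\<^sup>2 * ?b j)"
    by (rule order_trans[OF sum_abs sum_mono]) (rule R)
  also have "\<dots> = 2 * (real m)\<^sup>2 * L * h\<^sup>2"
    by (simp add: sum_distrib_left[symmetric] S1)
  finally have rest: "\<bar>\<Sum>j<N + m. R j * ?b j\<bar> \<le> 2 * (real m)\<^sup>2 * L * h\<^sup>2" .
  have "\<bar>f' (s - t) * (\<Sum>j<N + m. (real j * h - t - c) * ?b j)\<bar>
      \<le> (if m = 1 \<or> real m * h \<le> t then 0 else 2 * real m * h * \<bar>f' (s - t)\<bar>)"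
  proof (cases "m = 1 \<or> real m * h \<le> t")
    case True
    have "(\<Sum>j<N + m. (real j * h - t - c) * ?b j)
        = (\<Sum>j<N + m. (real j * h - c) * ?b j) - t * (\<Sum>j<N + m. ?b j)"
      by (simp add: sum_distrib_left sum_subtractf[symmetric] algebra_simps)
    also have "(\<Sum>j<N + m. (real j * h - c) * ?b j) = t"
      unfolding c_def by (rule bspline_first_moment[OF h t m True])
    finally show ?thesis using True S1 by simp
  next
    case False
    have "\<bar>(real j * h - t - c) * ?b j\<bar> \<le> 2 * real m * h * ?b j" for j
    proof (cases "?b j = 0")
      case False
      then have "\<bar>real j * h - t - c\<bar> \<le> 2 * real m * h"
        using bspline_nonzero_imp[OF h m t(1) False] c by linarith
      then show ?thesis using b[of j] by (simp add: abs_mult mult_right_mono)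
    qed simp
    then have "\<bar>\<Sum>j<N + m. (real j * h - t - c) * ?b j\<bar> \<le> (\<Sum>j<N + m. 2 * real m * h * ?b j)"
      by (intro order_trans[OF sum_abs sum_mono])
    also have "\<dots> = 2 * real m * h" by (simp add: sum_distrib_left[symmetric] S1)
    finally show ?thesis
      using False by (simp add: abs_mult mult.commute mult_left_mono)
  qed
  then show ?thesis using E rest by linarith
qed

section \<open>Weights\<close>

text \<open>Integer indices make the second differences uniform: weights with negative index are 0.\<close>

definition iweight :: "(real \<Rightarrow> real) \<Rightarrow> nat \<Rightarrow> real \<Rightarrow> int \<Rightarrow> real" where
  "iweight K m h j = integral {knot h (j - int m)..knot h (j + 1)} (\<lambda>t. K t * bspline h m (j - int m) t)"

lemma iweight_int: "iweight K m h (int j) = weight K m h j"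
  by (simp add: iweight_def weight_def)

lemma iweight_neg: "j < 0 \<Longrightarrow> iweight K m h j = 0"
  using bspline_index[of "j - int m" m h] by (simp add: iweight_def)

lemma continuous_on_bspline_Icc:
  assumes "0 < h" "1 \<le> m" "0 \<le> a"
  shows "continuous_on {a..b} (bspline h m j)"
proof -
  obtain k where "m = Suc k" using assms(2) by (cases m) auto
  then show ?thesis
    using continuous_on_subset[OF continuous_on_bspline[OF assms(1), of k j]] assms(3) by auto
qed

lemma knot_nonneg: "0 < h \<Longrightarrow> 0 \<le> knot h j"
  by (simp add: knot_def)

lemma iweight_superset:
  assumes h: "0 < h" and m: "1 \<le> m" and K: "continuous_on {0..T} K"
    and L: "knot h (j + 1) \<le> L" "L \<le> T"
  shows "iweight K m h j = integral {0..L} (\<lambda>t. K t * bspline h m (j - int m) t)"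
proof -
  let ?S = "{knot h (j - int m)..knot h (j + 1)}" and ?f = "\<lambda>t. K t * bspline h m (j - int m) t"
  have "continuous_on ?S ?f"
    using L knot_nonneg[OF h]
    by (intro continuous_intros continuous_on_subset[OF K] continuous_on_bspline_Icc h m) auto
  then have "(?f has_integral iweight K m h j) ?S"
    unfolding iweight_def by (intro integrable_integral integrable_continuous_interval)
  then have "(?f has_integral iweight K m h j) {0..L}"
  proof (rule has_integral_on_superset)
    fix t assume "t \<notin> ?S"
    then have "bspline h m (j - int m) t = 0"
      by (intro bspline_support[OF h]) auto
    then show "?f t = 0" by simp
  qed (use L knot_nonneg[OF h, of "j - int m"] in auto)
  then show ?thesis by (simp add: integral_unique)
qed

text \<open>A spline spans at most \<open>m + 1\<close> cells and its integral is the span divided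
  by \<open>m + 1\<close>, hence at most \<open>h\<close>.\<close>

lemma bspline_integral_bound:
  assumes h: "0 < h" and m: "1 \<le> m" and g: "continuous_on {0..L} g"
    and bd: "\<And>t. t \<in> {0..L} \<Longrightarrow> bspline h m j t \<noteq> 0 \<Longrightarrow> \<bar>g t\<bar> \<le> B"
    and j: "- int m \<le> j" and L: "knot h (j + int m + 1) \<le> L" and B: "0 \<le> B"
  shows "\<bar>integral {0..L} (\<lambda>t. g t * bspline h m j t)\<bar> \<le> B * h"
proof -
  have cb: "continuous_on {0..L} (bspline h m j)" by (rule continuous_on_bspline_Icc[OF h m order_refl])
  have "norm (integral {0..L} (\<lambda>t. g t * bspline h m j t)) \<le> integral {0..L} (\<lambda>t. B * bspline h m j t)"
  proof (rule integral_norm_bound_integral)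
    fix t assume t: "t \<in> {0..L}"
    show "norm (g t * bspline h m j t) \<le> B * bspline h m j t"
      using bd[OF t] bspline_nonneg[OF h, of m j t]
      by (cases "bspline h m j t = 0") (auto simp: abs_mult intro: mult_right_mono)
  qed (intro integrable_continuous_interval continuous_intros g cb)+
  also have "\<dots> = B * ((knot h (j + int m + 1) - knot h j) / real (m + 1))"
    using bspline_integral[OF h m j L] by simp
  also have "\<dots> \<le> B * h"
  proof (rule mult_left_mono[OF _ B])
    have "0 \<le> real m * h" using h by simp
    moreover have "knot h (j + int m + 1) - knot h j \<le> real (m + 1) * h"
    proof (cases "0 \<le> j")
      case True
      then show ?thesis by (simp add: knot_def algebra_simps)
    next
      case False
      have "real_of_int (j + int m + 1) * h \<le> real (m + 1) * h"
        using False h by (intro mult_right_mono) auto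
      then show ?thesis using False j by (simp add: knot_def)
    qed
    ultimately show "(knot h (j + int m + 1) - knot h j) / real (m + 1) \<le> h"
      by (simp add: divide_le_eq mult.commute)
  qed
  finally show ?thesis by simp
qed

text \<open>For \<open>K = 1\<close> the weight is the knot span over \<open>m + 1\<close>, and the
  truncated ramp encodes this span for negative indices too. The support lies before
  \<open>real (m + 2) * h\<close>, where \<open>K\<close> deviates from 1 by order \<open>h\<close>;
  integration adds another \<open>h\<close>.\<close>

lemma iweight_near:
  assumes h: "0 < h" and m: "1 \<le> m" and K: "continuous_on {0..T} K"
    and K1: "\<And>t. t \<in> {0..T} \<Longrightarrow> \<bar>K t - 1\<bar> \<le> B * t" and B: "0 \<le> B"
    and j: "knot h (j + 1) \<le> T" "j \<le> int m + 1"
  shows "\<bar>iweight K m h j - h * real_of_int (max 0 (min (j + 1) (int m + 1))) / real (m + 1)\<bar>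
    \<le> B * real (m + 2) * h\<^sup>2"
proof (cases "0 \<le> j")
  case True
  let ?b = "bspline h m (j - int m)" and ?L = "knot h (j + 1)"
  have L: "?L = real_of_int (j + 1) * h" using True by (simp add: knot_def)
  have cb: "continuous_on {0..?L} ?b" by (rule continuous_on_bspline_Icc[OF h m order_refl])
  have cK: "continuous_on {0..?L} K" using j by (intro continuous_on_subset[OF K]) auto
  have "iweight K m h j = integral {0..?L} (\<lambda>t. K t * ?b t)"
    by (rule iweight_superset[OF h m K order_refl j(1)])
  also have "\<dots> = integral {0..?L} (\<lambda>t. (K t - 1) * ?b t + ?b t)"
    by (intro integral_cong) (simp add: algebra_simps)
  also have "\<dots> = integral {0..?L} (\<lambda>t. (K t - 1) * ?b t) + integral {0..?L} ?b"
    by (intro integral_add integrable_continuous_interval continuous_intros cb cK)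
  also have "integral {0..?L} ?b = (knot h (j - int m + int m + 1) - knot h (j - int m)) / real (m + 1)"
    using True by (intro bspline_integral h m) auto
  also have "knot h (j - int m + int m + 1) - knot h (j - int m)
      = h * real_of_int (max 0 (min (j + 1) (int m + 1)))"
    using True by (auto simp: knot_def max_def min_def algebra_simps)
  finally have e: "iweight K m h j - h * real_of_int (max 0 (min (j + 1) (int m + 1))) / real (m + 1)
    = integral {0..?L} (\<lambda>t. (K t - 1) * ?b t)" by simp
  have "\<bar>integral {0..?L} (\<lambda>t. (K t - 1) * ?b t)\<bar> \<le> (B * (real (m + 2) * h)) * h"
  proof (rule bspline_integral_bound[OF h m])
    fix t assume t: "t \<in> {0..?L}"
    have "real_of_int (j + 1) * h \<le> real (m + 2) * h" using j h by (intro mult_right_mono) auto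
    then have "t \<le> real (m + 2) * h" using t L by auto
    then have "B * t \<le> B * (real (m + 2) * h)" using B by (intro mult_left_mono)
    moreover have "\<bar>K t - 1\<bar> \<le> B * t" using t j by (intro K1) auto
    ultimately show "\<bar>K t - 1\<bar> \<le> B * (real (m + 2) * h)" by linarith
  qed (use True h B in \<open>auto intro!: continuous_intros cK\<close>)
  then show ?thesis unfolding e by (simp add: power2_eq_square mult.assoc)
next
  case False
  then show ?thesis using B by (simp add: iweight_neg)
qed

section \<open>Second differences of the weights\<close>

lemma bspline_shift_nat:
  "0 \<le> i \<Longrightarrow> bspline h k (i + int e) t = bspline h k i (t - real e * h)"
proof (induction e arbitrary: t)
  case (Suc e)
  have "bspline h k (i + int (Suc e)) t = bspline h k (i + int e + 1) t" by (simp add: add.commute add.left_commute)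
  also have "\<dots> = bspline h k (i + int e) (t - h)" by (rule bspline_shift) (use Suc in simp)
  finally show ?case using Suc by (simp add: algebra_simps)
qed simp

lemma iweight_shift:
  assumes i: "int m \<le> i"
  shows "iweight K m h (i + int e) =
    integral {knot h (i - int m)..knot h (i + 1)} (\<lambda>t. K (t + real e * h) * bspline h m (i - int m) t)"
proof -
  have "iweight K m h (i + int e) = integral {knot h (i - int m) + real e * h..knot h (i + 1) + real e * h}
      (\<lambda>t. K t * bspline h m (i - int m + int e) t)"
    using i by (simp add: iweight_def knot_def algebra_simps)
  also have "\<dots> = integral {knot h (i - int m)..knot h (i + 1)}
      ((\<lambda>t. K t * bspline h m (i - int m + int e) t) \<circ> (+) (real e * h))"
    by (simp only: integral_shift_Icc_real)
  also have "\<dots> = integral {knot h (i - int m)..knot h (i + 1)} (\<lambda>t. K (t + real e * h) * bspline h m (i - int m) t)"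
  proof (rule integral_cong)
    fix t
    show "((\<lambda>t. K t * bspline h m (i - int m + int e) t) \<circ> (+) (real e * h)) t
        = K (t + real e * h) * bspline h m (i - int m) t"
      using bspline_shift_nat[of "i - int m" h m e "real e * h + t"] i
      unfolding o_def by (simp add: add.commute[of "real e * h" t])
  qed
  finally show ?thesis .
qed

text \<open>With \<open>int m + 2 \<le> j\<close> even the index \<open>j - 2\<close> belongs to an
  interior spline. The three splines are translates, so the difference moves onto \<open>K\<close>
  and is integrated against one spline.\<close>

lemma iweight_second_difference:
  assumes h: "0 < h" and m: "1 \<le> m" and K: "continuous_on {0..T} K"
    and K2: "\<And>t. 0 \<le> t \<Longrightarrow> t + 2 * h \<le> T \<Longrightarrow> \<bar>K (t + 2 * h) - 2 * K (t + h) + K t\<bar> \<le> B * h\<^sup>2"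
    and B: "0 \<le> B" and j: "knot h (j + 1) \<le> T" "int m + 2 \<le> j"
  shows "\<bar>iweight K m h j - 2 * iweight K m h (j - 1) + iweight K m h (j - 2)\<bar> \<le> B * h ^ 3"
proof -
  define i where "i = j - 2"
  let ?S = "{knot h (i - int m)..knot h (i + 1)}" and ?L = "knot h (i + 1)" and ?b = "bspline h m (i - int m)"
  have i: "int m \<le> i" "j = i + 2" using j by (auto simp: i_def)
  have L: "?L + 2 * h \<le> T" using i j m by (simp add: knot_def algebra_simps)
  have cK: "continuous_on {0..?L} (\<lambda>t. K (t + real e * h))" if "e \<le> 2" for e
  proof -
    have "real e * h \<le> 2 * h" using that h by (intro mult_right_mono) auto
    then have "t + real e * h \<le> T" if "t \<le> ?L" for t
      using L that by linarith
    then have "(\<lambda>t. t + real e * h) ` {0..?L} \<subseteq> {0..T}"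
      using h by auto
    then show ?thesis
      by (intro continuous_on_compose2[OF K] continuous_intros)
  qed
  have cb: "continuous_on {0..?L} ?b" by (rule continuous_on_bspline_Icc[OF h m order_refl])
  have int: "(\<lambda>t. K (t + real e * h) * ?b t) integrable_on {0..?L}" if "e \<le> 2" for e
    by (intro integrable_continuous_interval continuous_intros cb cK that)
  have w: "iweight K m h (i + int e) = integral {0..?L} (\<lambda>t. K (t + real e * h) * ?b t)" if "e \<le> 2" for e
  proof -
    have "?S \<subseteq> {0..?L}" using knot_nonneg[OF h, of "i - int m"] by auto
    then have "(\<lambda>t. K (t + real e * h) * ?b t) integrable_on ?S"
      using int[OF that] integrable_on_subinterval by blast
    then have "((\<lambda>t. K (t + real e * h) * ?b t) has_integral iweight K m h (i + int e)) ?S"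
      unfolding iweight_shift[OF i(1)] by (rule integrable_integral)
    then have "((\<lambda>t. K (t + real e * h) * ?b t) has_integral iweight K m h (i + int e)) {0..?L}"
    proof (rule has_integral_on_superset[OF _ _ \<open>?S \<subseteq> {0..?L}\<close>])
      fix t assume "t \<notin> ?S"
      then have "?b t = 0" by (intro bspline_support[OF h]) auto
      then show "K (t + real e * h) * ?b t = 0" by simp
    qed
    then show ?thesis by (simp add: integral_unique)
  qed
  have "iweight K m h j - 2 * iweight K m h (j - 1) + iweight K m h (j - 2)
      = integral {0..?L} (\<lambda>t. K (t + real 2 * h) * ?b t) - 2 * integral {0..?L} (\<lambda>t. K (t + real 1 * h) * ?b t)
        + integral {0..?L} (\<lambda>t. K (t + real 0 * h) * ?b t)"
    using w[of 2] w[of 1] w[of 0] i by (simp add: algebra_simps)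
  also have "\<dots> = integral {0..?L} (\<lambda>t. K (t + real 2 * h) * ?b t - 2 * (K (t + real 1 * h) * ?b t)
        + K (t + real 0 * h) * ?b t)"
    using int[of 2] int[of 1] int[of 0]
    by (subst integral_add integral_diff integral_mult_right,
        auto intro!: integrable_diff integrable_on_cmult_left)+
  also have "\<dots> = integral {0..?L} (\<lambda>t. (K (t + 2 * h) - 2 * K (t + h) + K t) * ?b t)"
    by (intro integral_cong) (simp add: algebra_simps)
  finally have e: "iweight K m h j - 2 * iweight K m h (j - 1) + iweight K m h (j - 2)
      = integral {0..?L} (\<lambda>t. (K (t + 2 * h) - 2 * K (t + h) + K t) * ?b t)" .
  have "\<bar>integral {0..?L} (\<lambda>t. (K (t + 2 * h) - 2 * K (t + h) + K t) * ?b t)\<bar> \<le> (B * h\<^sup>2) * h"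
  proof (rule bspline_integral_bound[OF h m])
    show "continuous_on {0..?L} (\<lambda>t. K (t + 2 * h) - 2 * K (t + h) + K t)"
      using cK[of 2] cK[of 1] cK[of 0] by (intro continuous_intros) auto
    fix t assume "t \<in> {0..?L}"
    then show "\<bar>K (t + 2 * h) - 2 * K (t + h) + K t\<bar> \<le> B * h\<^sup>2"
      using L by (intro K2) auto
  qed (use i B in auto)
  then show ?thesis unfolding e by (simp add: power2_eq_square power3_eq_cube mult.assoc)
qed

text \<open>The ramp of \<open>iweight_near\<close> bends only at -1 and \<open>int m\<close>, which
  the backward difference sees at 0 and \<open>int m + 1\<close>. The factor 4 is 1 + 2 + 1.\<close>

lemma iweight_perturbation:
  assumes h: "0 < h" and m: "1 \<le> m" and K: "continuous_on {0..T} K"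
    and K1: "\<And>t. t \<in> {0..T} \<Longrightarrow> \<bar>K t - 1\<bar> \<le> B * t"
    and K2: "\<And>t. 0 \<le> t \<Longrightarrow> t + 2 * h \<le> T \<Longrightarrow> \<bar>K (t + 2 * h) - 2 * K (t + h) + K t\<bar> \<le> B * h\<^sup>2"
    and B: "0 \<le> B" and j: "knot h (j + 1) \<le> T" "0 \<le> j"
  shows "\<bar>iweight K m h j - 2 * iweight K m h (j - 1) + iweight K m h (j - 2)
      - h / real (m + 1) * ((if j = 0 then 1 else 0) - (if j = int m + 1 then 1 else 0))\<bar>
    \<le> (if j \<le> int m + 1 then 4 * B * real (m + 2) * h\<^sup>2 else B * h ^ 3)"
proof (cases "j \<le> int m + 1")
  case True
  define g where "g j = real_of_int (max 0 (min (j + 1) (int m + 1)))" for j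
  define C where "C = B * real (m + 2) * h\<^sup>2"
  have k: "knot h (i + 1) \<le> T" if "i \<le> j" for i
    using knot_mono[OF h, of "i + 1" "j + 1"] that j by linarith
  have g: "g j - 2 * g (j - 1) + g (j - 2) = (if j = 0 then 1 else 0) - (if j = int m + 1 then 1 else 0)"
    using j True m by (auto simp: g_def max_def min_def)
  have near: "\<bar>iweight K m h i - h * g i / real (m + 1)\<bar> \<le> C" if "i \<le> j" for i
    unfolding g_def C_def using that True by (intro iweight_near[OF h m K K1 B k]) auto
  have "h / real (m + 1) * ((if j = 0 then 1 else 0) - (if j = int m + 1 then 1 else 0))
     = h * g j / real (m + 1) - 2 * (h * g (j - 1) / real (m + 1)) + h * g (j - 2) / real (m + 1)"
    unfolding g[symmetric] by (simp add: algebra_simps add_divide_distrib diff_divide_distrib)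
  moreover have "\<bar>iweight K m h j - h * g j / real (m + 1)\<bar> \<le> C"
    "\<bar>iweight K m h (j - 1) - h * g (j - 1) / real (m + 1)\<bar> \<le> C"
    "\<bar>iweight K m h (j - 2) - h * g (j - 2) / real (m + 1)\<bar> \<le> C"
    by (rule near, simp)+
  ultimately have "\<bar>iweight K m h j - 2 * iweight K m h (j - 1) + iweight K m h (j - 2)
      - h / real (m + 1) * ((if j = 0 then 1 else 0) - (if j = int m + 1 then 1 else 0))\<bar> \<le> 4 * C"
    by argo
  then show ?thesis using True unfolding C_def by (simp add: mult.assoc)
next
  case False
  then show ?thesis
    using iweight_second_difference[OF h m K K2 B j(1)] j(2) by simp
qed

section \<open>Stability and convergence\<close>

lemma second_difference_bound:
  fixes g g' g'' :: "real \<Rightarrow> real"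
  assumes S: "convex S" and h: "0 < h" and s: "s \<in> S" "s - 2 * h \<in> S"
    and g: "\<And>x. x \<in> S \<Longrightarrow> (g has_real_derivative g' x) (at x within S)"
    and g': "\<And>x. x \<in> S \<Longrightarrow> (g' has_real_derivative g'' x) (at x within S)"
    and B: "\<And>x. x \<in> S \<Longrightarrow> \<bar>g'' x\<bar> \<le> B"
  shows "\<bar>g s - 2 * g (s - h) + g (s - 2 * h)\<bar> \<le> B * h\<^sup>2"
proof -
  have seg: "x \<in> S" if "s - 2 * h \<le> x" "x \<le> s" for x
    using S s that by (meson convex_contains_segment closed_segment_eq_real_ivl subsetD
        atLeastAtMost_iff order_trans is_interval_convex_1 mem_is_interval_1_I)
  have lip: "\<bar>g' x - g' y\<bar> \<le> B * \<bar>x - y\<bar>" if "x \<in> S" "y \<in> S" for x y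
    using field_differentiable_bound[OF S g', of B x y] B that by simp
  let ?A = "{s - h..s}"
  have "norm ((\<lambda>z. g z - g (z - h)) s - (\<lambda>z. g z - g (z - h)) (s - h)) \<le> (B * h) * norm (s - (s - h))"
  proof (rule field_differentiable_bound[of ?A _ "\<lambda>z. g' z - g' (z - h)"])
    fix z assume z: "z \<in> ?A"
    then have zS: "z \<in> S" "z - h \<in> S" using h by (auto intro!: seg)
    have "(g has_real_derivative g' z) (at z within ?A)"
      by (rule DERIV_subset[OF g[OF zS(1)]]) (use h in \<open>auto intro!: seg\<close>)
    moreover have "((\<lambda>z. g (z - h)) has_real_derivative g' (z - h)) (at z within ?A)"
      by (rule DERIV_shift_within[OF g[OF zS(2)]]) (use h in \<open>auto intro!: seg\<close>)
    ultimately show "((\<lambda>z. g z - g (z - h)) has_real_derivative g' z - g' (z - h)) (at z within ?A)"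
      by (rule DERIV_diff)
    show "norm (g' z - g' (z - h)) \<le> B * h" using lip[OF zS] h by simp
  qed (use h in auto)
  then show ?thesis using h by (simp add: power2_eq_square algebra_simps)
qed

text \<open>The step is implicit, as \<open>M\<close> also bounds \<open>x n\<close>, and the
  predecessor \<open>k\<close> is arbitrary, which admits jumps of length \<open>m + 1\<close>. For
  \<open>\<alpha> \<le> 1 / 2\<close>, \<open>1 / (1 - \<alpha>)\<close> is at most
  \<open>1 + 2 * \<alpha>\<close>.\<close>

lemma discrete_gronwall:
  fixes x :: "nat \<Rightarrow> real"
  assumes \<alpha>: "0 \<le> \<alpha>" "\<alpha> \<le> 1 / 2" and \<beta>: "0 \<le> \<beta>" and x0: "x 0 = 0"
    and step: "\<And>n M. 1 \<le> n \<Longrightarrow> n \<le> N \<Longrightarrow> (\<And>i. i \<le> n \<Longrightarrow> \<bar>x i\<bar> \<le> M)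
       \<Longrightarrow> \<exists>k<n. \<bar>x n\<bar> \<le> \<bar>x k\<bar> + \<alpha> * M + \<beta>"
    and n: "n \<le> N"
  shows "\<bar>x n\<bar> \<le> real n * \<beta> * (1 + 2 * \<alpha>) ^ n"
proof -
  define S where "S n = real n * \<beta> * (1 + 2 * \<alpha>) ^ n" for n
  have "\<forall>i\<le>n. \<bar>x i\<bar> \<le> S n"
    using n
  proof (induction n)
    case 0
    then show ?case using x0 by (simp add: S_def)
  next
    case (Suc n)
    have IH: "\<bar>x i\<bar> \<le> S n" if "i \<le> n" for i using Suc that by simp
    define P where "P = (1 + 2 * \<alpha>) ^ n"
    have P: "1 \<le> P" unfolding P_def using \<alpha> by (intro one_le_power) auto
    have up: "(1 + 2 * \<alpha>) * (S n + \<beta>) \<le> S (Suc n)"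
    proof -
      have "\<beta> * 1 \<le> \<beta> * P" by (rule mult_left_mono[OF P \<beta>])
      then have "S n + \<beta> \<le> real (Suc n) * \<beta> * P" by (simp add: S_def P_def algebra_simps)
      then have "(1 + 2 * \<alpha>) * (S n + \<beta>) \<le> (1 + 2 * \<alpha>) * (real (Suc n) * \<beta> * P)"
        using \<alpha> by (intro mult_left_mono) auto
      then show ?thesis by (simp add: S_def P_def mult.assoc mult.left_commute)
    qed
    have Sn: "0 \<le> S n" using \<alpha> \<beta> by (simp add: S_def)
    then have "1 * (S n + \<beta>) \<le> (1 + 2 * \<alpha>) * (S n + \<beta>)"
      using \<alpha> \<beta> by (intro mult_right_mono) auto
    then have "S n + \<beta> \<le> S (Suc n)" using up by (metis mult_1 order_trans)
    then have le: "S n \<le> S (Suc n)" using \<beta> by linarith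
    \<comment> \<open>If the new value exceeds the old bound, it is the largest so far, so it can
      serve as \<open>M\<close> and the term with \<alpha> is absorbed on the left.\<close>
    have "\<bar>x (Suc n)\<bar> \<le> S (Suc n)"
    proof (cases "\<bar>x (Suc n)\<bar> \<le> S n")
      case False
      have "\<bar>x i\<bar> \<le> \<bar>x (Suc n)\<bar>" if "i \<le> Suc n" for i
        using IH[of i] False that by (cases "i = Suc n") auto
      then obtain k where "k < Suc n" "\<bar>x (Suc n)\<bar> \<le> \<bar>x k\<bar> + \<alpha> * \<bar>x (Suc n)\<bar> + \<beta>"
        using step[of "Suc n" "\<bar>x (Suc n)\<bar>"] Suc.prems by auto
      then have "(1 - \<alpha>) * \<bar>x (Suc n)\<bar> \<le> S n + \<beta>" using IH[of k] by (simp add: algebra_simps)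
      then have "(1 + 2 * \<alpha>) * ((1 - \<alpha>) * \<bar>x (Suc n)\<bar>) \<le> (1 + 2 * \<alpha>) * (S n + \<beta>)"
        using \<alpha> by (intro mult_left_mono) auto
      moreover have "1 * \<bar>x (Suc n)\<bar> \<le> ((1 + 2 * \<alpha>) * (1 - \<alpha>)) * \<bar>x (Suc n)\<bar>"
      proof (rule mult_right_mono)
        have "\<alpha> * \<alpha> \<le> \<alpha> * (1 / 2)" using \<alpha> by (intro mult_left_mono) auto
        then show "1 \<le> (1 + 2 * \<alpha>) * (1 - \<alpha>)" by (simp add: algebra_simps)
      qed simp
      ultimately show ?thesis using up by (simp add: mult.assoc)
    qed (use le in linarith)
    moreover have "\<bar>x i\<bar> \<le> S (Suc n)" if "i \<le> n" for i using IH[OF that] le by linarith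
    ultimately show ?case by (metis le_Suc_eq)
  qed
  then show ?thesis by (simp add: S_def)
qed

text \<open>Gives the sums for different \<open>k\<close>, possibly negative, the same unknowns and
  index range, so that they can be subtracted termwise.\<close>

lemma convolution_reindex:
  fixes W x :: "int \<Rightarrow> real"
  assumes W: "\<And>j. j < 0 \<Longrightarrow> W j = 0" and x: "\<And>i. i \<le> 0 \<Longrightarrow> x i = 0" and k: "k \<le> int n"
  shows "(\<Sum>j<n. W (int j) * x (k - int j)) = (\<Sum>i=1..int n. W (k - i) * x i)"
proof -
  have "(\<Sum>j<n. W (int j) * x (k - int j)) = (\<Sum>i=k - int n + 1..k. W (k - i) * x i)"
    by (rule sum.reindex_bij_witness[of _ "\<lambda>i. nat (k - i)" "\<lambda>j. k - int j"]) auto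
  also have "\<dots> = (\<Sum>i=1..k. W (k - i) * x i)"
    using k x by (intro sum.mono_neutral_right) auto
  also have "\<dots> = (\<Sum>i=1..int n. W (k - i) * x i)"
    using k W by (intro sum.mono_neutral_left) auto
  finally show ?thesis .
qed

text \<open>One step size and one coefficient sequence are fixed, with a single \<open>B\<close> for
  kernel and solution; constants built from \<open>m\<close>, \<open>T\<close> and \<open>B\<close>
  alone are then uniform in \<open>h\<close>, \<open>n\<close> and \<open>v\<close>.\<close>

locale convolution_scheme =
  fixes K a :: "real \<Rightarrow> real" and U :: "nat \<Rightarrow> real \<Rightarrow> real" and v :: "nat \<Rightarrow> real"
    and T h B :: real and m :: nat
  assumes h: "0 < h" and m: "1 \<le> m" and T: "0 < T"
    and K: "continuous_on {0..T} K"
    and K_bound: "\<And>t. t \<in> {0..T} \<Longrightarrow> \<bar>K t\<bar> \<le> B"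
    and K_near: "\<And>t. t \<in> {0..T} \<Longrightarrow> \<bar>K t - 1\<bar> \<le> B * t"
    and K_diff: "\<And>t. 0 \<le> t \<Longrightarrow> t + 2 * h \<le> T \<Longrightarrow> \<bar>K (t + 2 * h) - 2 * K (t + h) + K t\<bar> \<le> B * h\<^sup>2"
    and U_nonpos: "\<And>i t. i \<le> 4 \<Longrightarrow> t \<le> 0 \<Longrightarrow> U i t = 0"
    and U_deriv: "\<And>i t. i < 4 \<Longrightarrow> t \<le> T \<Longrightarrow> (U i has_real_derivative U (Suc i) t) (at t within {..T})"
    and U_bound: "\<And>i t. i \<le> 4 \<Longrightarrow> t \<le> T \<Longrightarrow> \<bar>U i t\<bar> \<le> B"
    and volterra: "\<And>t. t \<in> {0..T} \<Longrightarrow> integral {0..t} (\<lambda>s. K s * U 0 (t - s)) = a t"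
    and scheme: "scheme_coeffs K a T m h v"
    and weight_0: "weight K m h 0 \<noteq> 0"
begin

lemma B_nonneg: "0 \<le> B"
  using U_bound[of 0 0] T by force

lemma U_lipschitz:
  assumes "i < 4" "x \<le> T" "y \<le> T"
  shows "\<bar>U i x - U i y\<bar> \<le> B * \<bar>x - y\<bar>"
  using field_differentiable_bound[of "{..T}" "U i" "U (Suc i)" B x y] U_deriv U_bound assms by simp

definition diff2 :: "nat \<Rightarrow> real \<Rightarrow> real" where
  "diff2 i s = U i s - 2 * U i (s - h) + U i (s - 2 * h)"

lemma diff2_deriv:
  assumes "i < 4" "s \<le> T"
  shows "(diff2 i has_real_derivative diff2 (Suc i) s) (at s within {..T})"
proof -
  have sh: "((\<lambda>s. U i (s - c)) has_real_derivative U (Suc i) (s - c)) (at s within {..T})"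
    if "0 \<le> c" for c
    using assms that by (intro DERIV_shift_within[OF U_deriv[OF assms(1)]]) auto
  show ?thesis
    unfolding diff2_def[abs_def]
    using sh[of h] sh[of "2 * h"] U_deriv[OF assms] h
    by (auto intro!: derivative_eq_intros)
qed

lemma diff2_bound: "i \<le> 2 \<Longrightarrow> s \<le> T \<Longrightarrow> \<bar>diff2 i s\<bar> \<le> B * h\<^sup>2"
  unfolding diff2_def
  by (rule second_difference_bound[where S = "{..T}" and g' = "U (Suc i)" and g'' = "U (Suc (Suc i))"])
    (use h in \<open>auto intro!: U_deriv U_bound\<close>)

lemma diff2_lipschitz:
  assumes "x \<le> T" "y \<le> T"
  shows "\<bar>diff2 1 x - diff2 1 y\<bar> \<le> B * h\<^sup>2 * \<bar>x - y\<bar>"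
  using field_differentiable_bound[of "{..T}" "diff2 1" "diff2 2" "B * h\<^sup>2" x y]
    diff2_deriv[of 1] diff2_bound[of 2] assms by (simp add: numeral_2_eq_2)

section \<open>Equations for the coefficient error\<close>

abbreviation w :: "real \<Rightarrow> real" where
  "w \<equiv> quasi_interpolant (U 0) (U 1) m h"

abbreviation W :: "int \<Rightarrow> real" where
  "W \<equiv> iweight K m h"

lemma w_nonpos: "s \<le> 0 \<Longrightarrow> w s = 0"
  by (simp add: quasi_interpolant_def U_nonpos)

text \<open>The value 0 at nonpositive indices agrees with \<open>v 0 = 0\<close> and with
  \<open>w\<close> vanishing there, so sums may run past the start.\<close>

definition coeff_error :: "int \<Rightarrow> real" where
  "coeff_error i = (if i \<le> 0 then 0 else v (nat i) - w (real_of_int i * h))"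

lemma v_0: "v 0 = 0"
proof -
  have "a 0 = 0" using volterra[of 0] T by simp
  moreover have "a 0 = weight K m h 0 * v 0"
    using scheme[unfolded scheme_coeffs_def, rule_format, of 0] T by (simp add: knot_def)
  ultimately show ?thesis using weight_0 by simp
qed

lemma continuous_on_U0: "continuous_on {..T} (U 0)"
  using U_deriv[of 0] by (meson DERIV_continuous atMost_iff continuous_on_eq_continuous_within zero_less_numeral)

text \<open>For positive \<open>k\<close> both sides are the datum \<open>a\<close> at node
  \<open>k\<close>, by the scheme and by the Volterra equation, as the integrand vanishes beyond
  that node. Nonpositive \<open>k\<close> occur because second differences at \<open>n = 1\<close>
  reach index -1.\<close>

lemma data_convolution:
  assumes n: "real n * h \<le> T" and k: "k \<le> int n"
  shows "(\<Sum>j<n. W (int j) * (if k - int j \<le> 0 then 0 else v (nat (k - int j))))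
    = integral {0..real n * h} (\<lambda>t. K t * U 0 (real_of_int k * h - t))"
proof (cases "k \<le> 0")
  case True
  have "integral {0..real n * h} (\<lambda>t. K t * U 0 (real_of_int k * h - t)) = integral {0..real n * h} (\<lambda>t. 0)"
  proof (rule integral_cong)
    fix t assume "t \<in> {0..real n * h}"
    moreover have "real_of_int k * h \<le> 0" using True h by (simp add: mult_nonpos_nonneg)
    ultimately show "K t * U 0 (real_of_int k * h - t) = 0" by (simp add: U_nonpos)
  qed
  then show ?thesis using True by simp
next
  case False
  define k' where "k' = nat k"
  have k': "k = int k'" "k' \<le> n" using False k by (auto simp: k'_def)
  let ?f = "\<lambda>t. K t * U 0 (real k' * h - t)"
  have kn: "real k' * h \<le> real n * h" using k' h by (intro mult_right_mono) auto
  have kT: "real k' * h \<in> {0..T}" using order_trans[OF kn n] h by simp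
  have "continuous_on {0..real n * h} ?f"
    using n kT by (intro continuous_intros continuous_on_subset[OF K] continuous_on_compose2[OF continuous_on_U0]) auto
  then have "?f integrable_on {0..real n * h}" by (rule integrable_continuous_interval)
  then have "integral {0..real n * h} ?f = integral {0..real k' * h} ?f + integral {real k' * h..real n * h} ?f"
    using kn h by (intro Henstock_Kurzweil_Integration.integral_combine[symmetric]) auto
  also have "integral {real k' * h..real n * h} ?f = integral {real k' * h..real n * h} (\<lambda>t. 0)"
    by (rule integral_cong) (simp add: U_nonpos)
  also have "integral {0..real k' * h} ?f = a (real k' * h)"
    by (rule volterra[OF kT])
  also have "\<dots> = (\<Sum>j=0..k'. weight K m h j * v (k' - j))"
    using scheme kT unfolding scheme_coeffs_def by (simp add: knot_def)
  \<comment> \<open>The last term contains \<open>v 0 = 0\<close>; with it goes the weight whose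
    support may reach beyond \<open>T\<close>.\<close>
  also have "\<dots> = (\<Sum>j<k'. weight K m h j * v (k' - j))"
    using v_0 by (intro sum.mono_neutral_right) auto
  also have "\<dots> = (\<Sum>j<n. W (int j) * (if k - int j \<le> 0 then 0 else v (nat (k - int j))))"
    using k' by (intro sum.mono_neutral_cong_left) (auto simp: iweight_int nat_diff_distrib' of_nat_diff)
  finally show ?thesis using k' by simp
qed

lemma continuous_on_quasi_error:
  assumes "s \<le> T" "L \<le> T"
  shows "continuous_on {0..L} (\<lambda>t. K t * quasi_error (U 0) f m h M s t)"
  unfolding quasi_error_def using assms
  by (intro continuous_intros continuous_on_subset[OF K] continuous_on_compose2[OF continuous_on_U0]
      continuous_on_bspline_Icc h m) auto

text \<open>The part of the equations due to \<open>w\<close> is merged with the exact data under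
  one integral. The interval and \<open>M\<close> do not depend on \<open>k\<close>, so that
  differences in \<open>k\<close> can be taken. Surplus terms \<open>j \<ge> n\<close> have
  nonpositive argument in \<open>w\<close>.\<close>

lemma residual:
  assumes n: "real n * h \<le> T" and k: "k \<le> int n" and M: "n \<le> M"
  shows "(\<Sum>j<n. W (int j) * coeff_error (k - int j))
    = integral {0..real n * h} (\<lambda>t. K t * quasi_error (U 0) (U 1) m h M (real_of_int k * h) t)"
proof -
  let ?b = "\<lambda>j t. bspline h m (int j - int m) t" and ?s = "real_of_int k * h" and ?L = "real n * h"
  have sT: "?s \<le> T"
  proof -
    have "?s \<le> real n * h" using k h by (intro mult_right_mono) auto
    then show ?thesis using n by linarith
  qed
  have cL: "continuous_on {0..?L} K" using n by (intro continuous_on_subset[OF K]) auto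
  have cb: "continuous_on {0..?L} (?b j)" for j
    by (intro continuous_on_bspline_Icc h m) auto
  have wj: "W (int j) = integral {0..?L} (\<lambda>t. K t * ?b j t)" if "j < n" for j
  proof (rule iweight_superset[OF h m K _ n])
    have "real (Suc j) * h \<le> real n * h" using that h by (intro mult_right_mono) auto
    then show "knot h (int j + 1) \<le> ?L" by (simp add: knot_def add.commute)
  qed
  have "(\<Sum>j<n. W (int j) * coeff_error (k - int j))
     = (\<Sum>j<n. W (int j) * (if k - int j \<le> 0 then 0 else v (nat (k - int j))))
       - (\<Sum>j<n. W (int j) * w (?s - real j * h))"
    unfolding sum_subtractf[symmetric]
  proof (rule sum.cong[OF refl])
    fix j
    have "w (real_of_int (k - int j) * h) = 0" if "k - int j \<le> 0"
      using that h by (intro w_nonpos mult_nonpos_nonneg) auto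
    moreover have "real_of_int (k - int j) * h = ?s - real j * h" by (simp add: algebra_simps)
    ultimately show "W (int j) * coeff_error (k - int j)
      = W (int j) * (if k - int j \<le> 0 then 0 else v (nat (k - int j))) - W (int j) * w (?s - real j * h)"
      unfolding coeff_error_def by (auto simp: right_diff_distrib)
  qed
  also have "(\<Sum>j<n. W (int j) * w (?s - real j * h))
      = (\<Sum>j<n. integral {0..?L} (\<lambda>t. K t * (w (?s - real j * h) * ?b j t)))"
  proof (rule sum.cong[OF refl])
    fix j assume "j \<in> {..<n}"
    then have "W (int j) * w (?s - real j * h) = integral {0..?L} (\<lambda>t. K t * ?b j t * w (?s - real j * h))"
      by (simp only: lessThan_iff wj integral_mult_left)
    then show "W (int j) * w (?s - real j * h) = integral {0..?L} (\<lambda>t. K t * (w (?s - real j * h) * ?b j t))"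
      by (simp only: mult.assoc mult.commute[of "?b j _"])
  qed
  also have "\<dots> = integral {0..?L} (\<lambda>t. \<Sum>j<n. K t * (w (?s - real j * h) * ?b j t))"
    by (intro integral_sum[symmetric] integrable_continuous_interval continuous_intros cL cb) auto
  also have "\<dots> = integral {0..?L} (\<lambda>t. K t * (\<Sum>j<M. w (?s - real j * h) * ?b j t))"
  proof (rule integral_cong)
    fix t
    have "(\<Sum>j<n. w (?s - real j * h) * ?b j t) = (\<Sum>j<M. w (?s - real j * h) * ?b j t)"
    proof (rule sum.mono_neutral_left)
      show "\<forall>j\<in>{..<M} - {..<n}. w (?s - real j * h) * ?b j t = 0"
      proof
        fix j assume "j \<in> {..<M} - {..<n}"
        then have "?s \<le> real j * h" using k h by (intro mult_right_mono) auto
        then have "w (?s - real j * h) = 0" by (intro w_nonpos) simp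
        then show "w (?s - real j * h) * ?b j t = 0" by simp
      qed
    qed (use M in auto)
    then show "(\<Sum>j<n. K t * (w (?s - real j * h) * ?b j t)) = K t * (\<Sum>j<M. w (?s - real j * h) * ?b j t)"
      by (simp only: sum_distrib_left[symmetric])
  qed
  also have "(\<Sum>j<n. W (int j) * (if k - int j \<le> 0 then 0 else v (nat (k - int j))))
      = integral {0..?L} (\<lambda>t. K t * U 0 (?s - t))"
    by (rule data_convolution[OF n k])
  also have "integral {0..?L} (\<lambda>t. K t * U 0 (?s - t)) - integral {0..?L} (\<lambda>t. K t * (\<Sum>j<M. w (?s - real j * h) * ?b j t))
     = integral {0..?L} (\<lambda>t. K t * U 0 (?s - t) - K t * (\<Sum>j<M. w (?s - real j * h) * ?b j t))"
    using n sT by (intro integral_diff[symmetric] integrable_continuous_interval continuous_intros cL cb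
        continuous_on_compose2[OF continuous_on_U0]) auto
  finally show ?thesis unfolding quasi_error_def by (simp add: right_diff_distrib)
qed

text \<open>The quasi-error is linear in the functions and commutes with shifts of \<open>s\<close>.
  Hence \<open>quasi_error_bound\<close> applies to \<open>diff2 0\<close>, whose derivative has
  bound and Lipschitz constant of order \<open>h\<^sup>2\<close>.\<close>

lemma quasi_error_diff2:
  "quasi_error (diff2 0) (diff2 1) m h M s t = quasi_error (U 0) (U 1) m h M s t
     - 2 * quasi_error (U 0) (U 1) m h M (s - h) t + quasi_error (U 0) (U 1) m h M (s - 2 * h) t"
proof -
  let ?b = "\<lambda>j. bspline h m (int j - int m) t"
  have "quasi_interpolant (diff2 0) (diff2 1) m h (s - real j * h) * ?b j
      = w (s - real j * h) * ?b j - 2 * (w (s - h - real j * h) * ?b j) + w (s - 2 * h - real j * h) * ?b j" for j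
  proof -
    have e: "s - real j * h - h = s - h - real j * h" "s - real j * h - 2 * h = s - 2 * h - real j * h" by simp_all
    show ?thesis unfolding quasi_interpolant_def diff2_def e by (simp add: algebra_simps)
  qed
  moreover have "diff2 0 (s - t) = U 0 (s - t) - 2 * U 0 (s - h - t) + U 0 (s - 2 * h - t)"
  proof -
    have e: "s - t - h = s - h - t" "s - t - 2 * h = s - 2 * h - t" by simp_all
    show ?thesis unfolding diff2_def e ..
  qed
  ultimately show ?thesis
    unfolding quasi_error_def
    by (simp add: sum.distrib sum_subtractf sum_distrib_left[symmetric])
qed

text \<open>Beyond the layer the integrand is of order \<open>h ^ 4\<close> over a length at most
  \<open>T\<close>; inside it is only of order \<open>h ^ 3\<close>, but the layer has width
  \<open>real m * h\<close>.\<close>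

lemma residual_second_difference:
  assumes n: "real n * h \<le> T" "1 \<le> n"
  shows "\<bar>\<Sum>i=1..int n. (W (int n - i) - 2 * W (int n - i - 1) + W (int n - i - 2)) * coeff_error i\<bar>
     \<le> 2 * (real m)\<^sup>2 * B\<^sup>2 * (1 + T) * h ^ 4"
proof -
  \<comment> \<open>\<open>Suc n + m\<close> splines sum to 1 strictly before node
    \<open>Suc n\<close>, which includes the end point \<open>?L\<close>.\<close>
  let ?L = "real n * h" and ?M = "Suc n + m"
  define G where "G t = K t * quasi_error (diff2 0) (diff2 1) m h ?M ?L t" for t
  define q where "q k = integral {0..?L} (\<lambda>t. K t * quasi_error (U 0) (U 1) m h ?M (real_of_int k * h) t)" for k
  have L0: "0 \<le> ?L" using h by simp
  have q: "(\<Sum>i=1..int n. W (k - i) * coeff_error i) = q k" if "k \<le> int n" for k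
    unfolding q_def using residual[OF n(1) that, of ?M] that
    by (subst convolution_reindex[symmetric]) (auto simp: iweight_neg coeff_error_def)
  have int: "(\<lambda>t. K t * quasi_error (U 0) (U 1) m h ?M (?L - c) t) integrable_on {0..?L}" if "0 \<le> c" for c
    using n(1) that by (intro integrable_continuous_interval continuous_on_quasi_error) auto
  have e: "real_of_int (int n - 1) * h = ?L - h" "real_of_int (int n - 2) * h = ?L - 2 * h"
    by (simp_all add: algebra_simps)
  have "(\<Sum>i=1..int n. (W (int n - i) - 2 * W (int n - i - 1) + W (int n - i - 2)) * coeff_error i)
      = (\<Sum>i=1..int n. W (int n - i) * coeff_error i) - 2 * (\<Sum>i=1..int n. W (int n - 1 - i) * coeff_error i)
        + (\<Sum>i=1..int n. W (int n - 2 - i) * coeff_error i)"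
    unfolding sum_distrib_left sum_subtractf[symmetric] sum.distrib[symmetric]
    by (intro sum.cong) (auto simp: algebra_simps)
  also have "\<dots> = q (int n) - 2 * q (int n - 1) + q (int n - 2)"
    by (simp add: q)
  also have "\<dots> = integral {0..?L} (\<lambda>t. K t * quasi_error (U 0) (U 1) m h ?M ?L t
      - 2 * (K t * quasi_error (U 0) (U 1) m h ?M (?L - h) t)
      + K t * quasi_error (U 0) (U 1) m h ?M (?L - 2 * h) t)"
    unfolding q_def e using int[of 0] int[of h] int[of "2 * h"] h
    by (subst integral_add integral_diff integral_mult_right,
        auto intro!: integrable_diff integrable_on_cmult_left)+
  also have "\<dots> = integral {0..?L} G"
    by (intro integral_cong) (simp only: G_def quasi_error_diff2, simp add: algebra_simps)
  finally have sum_eq: "(\<Sum>i=1..int n. (W (int n - i) - 2 * W (int n - i - 1) + W (int n - i - 2)) * coeff_error i)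
      = integral {0..?L} G" .
  have cG: "continuous_on {0..?L} G"
  proof -
    have "G = (\<lambda>t. K t * quasi_error (U 0) (U 1) m h ?M ?L t
      - 2 * (K t * quasi_error (U 0) (U 1) m h ?M (?L - h) t)
      + K t * quasi_error (U 0) (U 1) m h ?M (?L - 2 * h) t)"
      unfolding G_def[abs_def] quasi_error_diff2 by (rule ext) (simp add: algebra_simps)
    then show ?thesis
      using n(1) h by (auto intro!: continuous_intros continuous_on_quasi_error)
  qed
  define A where "A = B * (2 * (real m)\<^sup>2 * B * h ^ 4)"
  define A' where "A' = B * (2 * real m * B * h ^ 3)"
  have A: "0 \<le> A" "0 \<le> A'" using B_nonneg h by (auto simp: A_def A'_def)
  have G: "\<bar>G t\<bar> \<le> (if real m * h \<le> t then 0 else A') + A" if t: "t \<in> {0..?L}" for t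
  proof -
    have "0 \<le> B * h\<^sup>2" using B_nonneg by simp
    have "?L < real (Suc n) * h" using h by (simp add: algebra_simps)
    then have "t < real (Suc n) * h" using t by simp
    then have "\<bar>quasi_error (diff2 0) (diff2 1) m h ?M ?L t\<bar>
       \<le> (if m = 1 \<or> real m * h \<le> t then 0 else 2 * real m * h * \<bar>diff2 1 (?L - t)\<bar>)
         + 2 * (real m)\<^sup>2 * (B * h\<^sup>2) * h\<^sup>2"
      using diff2_deriv[of 0] diff2_lipschitz t n(1) \<open>0 \<le> B * h\<^sup>2\<close>
      by (intro quasi_error_bound[of T] h m) auto
    also have "\<dots> \<le> (if real m * h \<le> t then 0 else 2 * real m * B * h ^ 3) + 2 * (real m)\<^sup>2 * B * h ^ 4"
    proof -
      have "2 * real m * h * \<bar>diff2 1 (?L - t)\<bar> \<le> 2 * real m * h * (B * h\<^sup>2)"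
        using t n(1) h by (intro mult_left_mono diff2_bound) auto
      also have "\<dots> = 2 * real m * B * h ^ 3" by (simp add: power2_eq_square power3_eq_cube)
      finally have 1: "2 * real m * h * \<bar>diff2 1 (?L - t)\<bar> \<le> 2 * real m * B * h ^ 3" .
      have 2: "0 \<le> 2 * real m * B * h ^ 3" using B_nonneg h by simp
      have 3: "2 * (real m)\<^sup>2 * (B * h\<^sup>2) * h\<^sup>2 = 2 * (real m)\<^sup>2 * B * h ^ 4"
        by (simp add: power2_eq_square power4_eq_xxxx)
      have "(if P then 0 else X) + Z \<le> (if Q then 0 else Y) + Z'"
        if "Q \<Longrightarrow> P" "X \<le> Y" "0 \<le> Y" "Z = Z'" for P Q and X Y Z Z' :: real
        using that by auto
      from this[OF _ 1 2 3, of "real m * h \<le> t" "m = 1 \<or> real m * h \<le> t"]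
      show ?thesis by simp
    qed
    finally have "\<bar>K t\<bar> * \<bar>quasi_error (diff2 0) (diff2 1) m h ?M ?L t\<bar>
       \<le> B * ((if real m * h \<le> t then 0 else 2 * real m * B * h ^ 3) + 2 * (real m)\<^sup>2 * B * h ^ 4)"
      using t n(1) B_nonneg by (intro mult_mono K_bound) auto
    then show ?thesis by (simp add: G_def A_def A'_def abs_mult distrib_left split: if_splits)
  qed
  \<comment> \<open>For \<open>n \<le> m\<close> the layer covers the whole interval; otherwise the
    integral is split at its end.\<close>
  have "\<bar>integral {0..?L} G\<bar> \<le> A' * (real m * h) + A * ?L"
  proof (cases "n \<le> m")
    case True
    have le: "?L \<le> real m * h" using True h by (intro mult_right_mono) auto
    have "norm (integral {0..?L} G) \<le> (A' + A) * (?L - 0)"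
    proof (rule integral_bound[OF L0 cG])
      fix t assume "t \<in> {0..?L}"
      then show "norm (G t) \<le> A' + A" using G[of t] A by (auto split: if_splits)
    qed
    moreover have "A' * ?L \<le> A' * (real m * h)" by (rule mult_left_mono[OF le A(2)])
    ultimately show ?thesis by (simp add: distrib_right)
  next
    case False
    have le: "real m * h \<le> ?L" "0 \<le> real m * h" using False h by (auto intro!: mult_right_mono)
    have "norm (integral {0..real m * h} G) \<le> (A' + A) * (real m * h - 0)"
    proof (rule integral_bound[OF le(2)])
      fix t assume "t \<in> {0..real m * h}"
      then show "norm (G t) \<le> A' + A" using G[of t] A le by (auto split: if_splits)
    qed (use le in \<open>auto intro: continuous_on_subset[OF cG]\<close>)
    moreover have "norm (integral {real m * h..?L} G) \<le> A * (?L - real m * h)"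
    proof (rule integral_bound[OF le(1)])
      fix t assume "t \<in> {real m * h..?L}"
      then show "norm (G t) \<le> A" using G[of t] le by (auto split: if_splits)
    qed (use le in \<open>auto intro: continuous_on_subset[OF cG]\<close>)
    moreover have "integral {0..?L} G = integral {0..real m * h} G + integral {real m * h..?L} G"
      using le integrable_continuous_interval[OF cG]
      by (intro Henstock_Kurzweil_Integration.integral_combine[symmetric]) auto
    ultimately show ?thesis by (simp add: algebra_simps)
  qed
  also have "\<dots> \<le> A' * (real m * h) + A * T"
    using mult_left_mono[OF n(1) A(1)] by simp
  also have "\<dots> = 2 * (real m)\<^sup>2 * B\<^sup>2 * (1 + T) * h ^ 4"
    by (simp add: A_def A'_def power2_eq_square power3_eq_cube power4_eq_xxxx algebra_simps)
  finally show ?thesis unfolding sum_eq .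
qed

text \<open>Dividing by the leading weight \<open>h / real (m + 1)\<close> costs one power of
  \<open>h\<close>: the residual becomes \<open>h ^ 3\<close>, and the perturbation, at most
  \<open>m + 2\<close> weights of order \<open>h\<^sup>2\<close> and \<open>T / h\<close> of order
  \<open>h ^ 3\<close>, becomes \<open>h * M\<close>.\<close>

lemma coeff_error_step:
  assumes n: "real n * h \<le> T" "1 \<le> n" and M: "\<And>i. i \<le> int n \<Longrightarrow> \<bar>coeff_error i\<bar> \<le> M"
  defines "A \<equiv> real (m + 1) * (B * (4 * (real (m + 2))\<^sup>2 + T) + 2 * (real m)\<^sup>2 * B\<^sup>2 * (1 + T))"
  shows "\<bar>coeff_error (int n)\<bar> \<le> \<bar>coeff_error (int n - int m - 1)\<bar> + A * h * M + A * h ^ 3"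
proof -
  let ?x = coeff_error and ?q = "h / real (m + 1)"
  define p where "p j = W j - 2 * W (j - 1) + W (j - 2)" for j
  define e where "e j = (if j = 0 then 1 else 0) - (if j = int m + 1 then 1 else 0 :: real)" for j
  define C where "C = 2 * (real m)\<^sup>2 * B\<^sup>2 * (1 + T)"
  have C: "0 \<le> C" using T by (simp add: C_def)
  have M0: "0 \<le> M" using M[of "int n"] by linarith
  have "(\<Sum>i=1..int n. e (int n - i) * ?x i)
      = (\<Sum>i=1..int n. if i = int n then ?x i else 0) - (\<Sum>i=1..int n. if i = int n - int m - 1 then ?x i else 0)"
    unfolding sum_subtractf[symmetric] e_def by (intro sum.cong) auto
  \<comment> \<open>A nonpositive index \<open>int n - int m - 1\<close> is missing from the sum, in
    agreement with \<open>coeff_error\<close> being 0 there.\<close>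
  also have "\<dots> = ?x (int n) - ?x (int n - int m - 1)"
    using n(2) by (auto simp: sum.delta coeff_error_def)
  finally have lead: "(\<Sum>i=1..int n. e (int n - i) * ?x i) = ?x (int n) - ?x (int n - int m - 1)" .
  have "\<bar>\<Sum>i=1..int n. (p (int n - i) - ?q * e (int n - i)) * ?x i\<bar>
      \<le> (\<Sum>i=1..int n. (if int n - i \<le> int m + 1 then 4 * B * real (m + 2) * h\<^sup>2 else B * h ^ 3) * M)"
  proof (rule order_trans[OF sum_abs sum_mono])
    fix i assume i: "i \<in> {1..int n}"
    have "real_of_int (int n - i + 1) * h \<le> real n * h" using i h by (intro mult_right_mono) auto
    then have "knot h (int n - i + 1) \<le> T" using i n by (simp add: knot_def)
    then have "\<bar>p (int n - i) - ?q * e (int n - i)\<bar>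
        \<le> (if int n - i \<le> int m + 1 then 4 * B * real (m + 2) * h\<^sup>2 else B * h ^ 3)"
      unfolding p_def e_def using i by (intro iweight_perturbation[OF h m K K_near K_diff B_nonneg]) auto
    then show "\<bar>(p (int n - i) - ?q * e (int n - i)) * ?x i\<bar>
        \<le> (if int n - i \<le> int m + 1 then 4 * B * real (m + 2) * h\<^sup>2 else B * h ^ 3) * M"
      unfolding abs_mult using i by (intro mult_mono M) auto
  qed
  \<comment> \<open>The near weights belong to the last \<open>m + 2\<close> indices
    \<open>i\<close>; adding the far bound for all \<open>i\<close> only enlarges the sum.\<close>
  also have "\<dots> \<le> (\<Sum>i=1..int n. (if i \<in> {int n - int m - 1..int n} then 4 * B * real (m + 2) * h\<^sup>2 * M else 0) + B * h ^ 3 * M)"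
    using B_nonneg h M0 by (intro sum_mono) auto
  also have "\<dots> = (\<Sum>i\<in>{1..int n} \<inter> {int n - int m - 1..int n}. 4 * B * real (m + 2) * h\<^sup>2 * M) + real n * (B * h ^ 3 * M)"
    by (simp only: sum.distrib sum.inter_restrict[OF finite_atLeastAtMost_int]) simp
  also have "\<dots> \<le> real (m + 2) * (4 * B * real (m + 2) * h\<^sup>2 * M) + real n * (B * h ^ 3 * M)"
  proof -
    have "card ({1..int n} \<inter> {int n - int m - 1..int n}) \<le> card {int n - int m - 1..int n}"
      by (intro card_mono) auto
    then have "real (card ({1..int n} \<inter> {int n - int m - 1..int n})) \<le> real (m + 2)" by simp
    then show ?thesis using B_nonneg h M0 by (simp add: mult_right_mono del: of_nat_add)
  qed
  also have "real n * (B * h ^ 3 * M) = (real n * h) * (B * h\<^sup>2 * M)"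
    by (simp add: power2_eq_square power3_eq_cube)
  also have "\<dots> \<le> T * (B * h\<^sup>2 * M)"
    using n B_nonneg M0 by (intro mult_right_mono) auto
  finally have pert: "\<bar>\<Sum>i=1..int n. (p (int n - i) - ?q * e (int n - i)) * ?x i\<bar>
      \<le> B * (4 * (real (m + 2))\<^sup>2 + T) * h\<^sup>2 * M"
    by (simp add: power2_eq_square algebra_simps)
  have res: "\<bar>\<Sum>i=1..int n. p (int n - i) * ?x i\<bar> \<le> C * h ^ 4"
    unfolding p_def C_def by (rule residual_second_difference[OF n])
  have "?q * (?x (int n) - ?x (int n - int m - 1))
      = (\<Sum>i=1..int n. p (int n - i) * ?x i) - (\<Sum>i=1..int n. (p (int n - i) - ?q * e (int n - i)) * ?x i)"
    unfolding lead[symmetric] sum_distrib_left sum_subtractf[symmetric]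
    by (intro sum.cong) (auto simp: algebra_simps)
  then have "\<bar>?q * (?x (int n) - ?x (int n - int m - 1))\<bar> \<le> C * h ^ 4 + B * (4 * (real (m + 2))\<^sup>2 + T) * h\<^sup>2 * M"
    by (simp only: order_trans[OF abs_triangle_ineq4 add_mono[OF res pert]])
  also have "\<bar>?q * (?x (int n) - ?x (int n - int m - 1))\<bar> = ?q * \<bar>?x (int n) - ?x (int n - int m - 1)\<bar>"
    using h by (simp add: abs_mult)
  also have "C * h ^ 4 + B * (4 * (real (m + 2))\<^sup>2 + T) * h\<^sup>2 * M
      = ?q * (real (m + 1) * (B * (4 * (real (m + 2))\<^sup>2 + T)) * h * M + real (m + 1) * C * h ^ 3)"
    by (simp add: power2_eq_square power3_eq_cube power4_eq_xxxx field_simps del: of_nat_add)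
  finally have "\<bar>?x (int n) - ?x (int n - int m - 1)\<bar>
      \<le> real (m + 1) * (B * (4 * (real (m + 2))\<^sup>2 + T)) * h * M + real (m + 1) * C * h ^ 3"
    using h by (subst (asm) mult_le_cancel_left_pos) auto
  moreover have "real (m + 1) * (B * (4 * (real (m + 2))\<^sup>2 + T)) * h * M \<le> A * h * M"
    unfolding A_def C_def[symmetric] using C h M0 by (intro mult_right_mono mult_left_mono) auto
  moreover have "real (m + 1) * C * h ^ 3 \<le> A * h ^ 3"
    unfolding A_def C_def[symmetric] using B_nonneg T h by (intro mult_right_mono mult_left_mono) auto
  ultimately show ?thesis by linarith
qed

text \<open>Gronwall with \<open>A * h\<close> and \<open>A * h ^ 3\<close>, where
  \<open>small\<close> is the condition on \<alpha>; \<open>real n * h \<le> T\<close> turns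
  \<open>real n * h ^ 3\<close> into \<open>T * h\<^sup>2\<close> and the power into an
  exponential.\<close>

lemma coeff_error_bound:
  defines "A \<equiv> real (m + 1) * (B * (4 * (real (m + 2))\<^sup>2 + T) + 2 * (real m)\<^sup>2 * B\<^sup>2 * (1 + T))"
  assumes n: "real n * h \<le> T" and small: "2 * A * h \<le> 1"
  shows "\<bar>coeff_error (int n)\<bar> \<le> T * A * exp (2 * A * T) * h\<^sup>2"
proof -
  have A: "0 \<le> A" using B_nonneg T by (simp add: A_def)
  have "\<bar>coeff_error (int n)\<bar> \<le> real n * (A * h ^ 3) * (1 + 2 * (A * h)) ^ n"
  proof (rule discrete_gronwall[where x = "\<lambda>n. coeff_error (int n)" and N = n])
    fix k M assume k: "1 \<le> k" "k \<le> n" and M: "\<And>i. i \<le> k \<Longrightarrow> \<bar>coeff_error (int i)\<bar> \<le> M"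
    have "real k * h \<le> real n * h" using k h by (intro mult_right_mono) auto
    then have kT: "real k * h \<le> T" using n by linarith
    have "\<bar>coeff_error i\<bar> \<le> M" if "i \<le> int k" for i
    proof (cases "i \<le> 0")
      case True
      then show ?thesis using M[of 0] by (simp add: coeff_error_def)
    next
      case False
      then show ?thesis using M[of "nat i"] that by simp
    qed
    from coeff_error_step[OF kT k(1) this]
    have "\<bar>coeff_error (int k)\<bar> \<le> \<bar>coeff_error (int k - int m - 1)\<bar> + A * h * M + A * h ^ 3"
      unfolding A_def by blast
    \<comment> \<open>For \<open>k \<le> m\<close> natural subtraction truncates to index 0, where
      \<open>coeff_error\<close> is 0, as it is at negative indices.\<close>
    moreover have "coeff_error (int k - int m - 1) = coeff_error (int (k - m - 1))"
    proof (cases "m + 1 \<le> k")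
      case True
      then have "int k - int m - 1 = int (k - m - 1)" by simp
      then show ?thesis by (rule arg_cong)
    qed (simp add: coeff_error_def)
    ultimately show "\<exists>l<k. \<bar>coeff_error (int k)\<bar> \<le> \<bar>coeff_error (int l)\<bar> + A * h * M + A * h ^ 3"
      using k(1) by (intro exI[of _ "k - m - 1"]) auto
  qed (use A h small in \<open>auto simp: coeff_error_def\<close>)
  also have "\<dots> \<le> real n * (A * h ^ 3) * exp (2 * A * T)"
  proof (rule mult_left_mono)
    have "(1 + 2 * (A * h)) ^ n \<le> exp (2 * (A * h)) ^ n"
      using A h by (intro power_mono exp_ge_add_one_self) auto
    also have "\<dots> = exp (2 * A * (real n * h))" by (simp add: exp_of_nat_mult[symmetric] mult_ac)
    also have "\<dots> \<le> exp (2 * A * T)" using n A by (simp add: mult_left_mono)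
    finally show "(1 + 2 * (A * h)) ^ n \<le> exp (2 * A * T)" .
  qed (use A h in auto)
  also have "real n * (A * h ^ 3) * exp (2 * A * T) = (real n * h) * (A * exp (2 * A * T) * h\<^sup>2)"
    by (simp add: power2_eq_square power3_eq_cube)
  also have "\<dots> \<le> T * (A * exp (2 * A * T) * h\<^sup>2)"
    using n A by (intro mult_right_mono) auto
  finally show ?thesis by (simp add: mult.assoc)
qed

text \<open>The error is the quasi-error minus the spline of the coefficient errors. Nonnegative
  splines with sum at most 1 preserve the bound on the latter, and the condition on \<open>t\<close>
  excludes the layer.\<close>

lemma approx_error_bound:
  defines "A \<equiv> real (m + 1) * (B * (4 * (real (m + 2))\<^sup>2 + T) + 2 * (real m)\<^sup>2 * B\<^sup>2 * (1 + T))"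
  assumes u: "\<And>t. t \<le> T \<Longrightarrow> U 0 t = zero_ext u t"
    and n: "real n * h \<le> T" and small: "2 * A * h \<le> 1" and t: "t \<in> {0..T}" "m = 1 \<or> real m * h \<le> t"
  shows "\<bar>approx_error u m h v n t\<bar> \<le> (2 * (real m)\<^sup>2 * B + T * A * exp (2 * A * T)) * h\<^sup>2"
proof -
  let ?b = "\<lambda>j. bspline h m (int j - int m) t" and ?s = "real n * h"
  define D where "D = T * A * exp (2 * A * T) * h\<^sup>2"
  \<comment> \<open>Large enough to include all splines of the scheme and to have
    \<open>T < real N * h\<close>.\<close>
  define N where "N = Suc n + nat \<lceil>T / h\<rceil>"
  have b: "0 \<le> ?b j" for j by (rule bspline_nonneg[OF h])
  have "T / h < real N" unfolding N_def by linarith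
  then have tN: "t < real N * h" using t h by (simp add: divide_less_eq)
  have "quasi_error (U 0) (U 1) m h (N + m) ?s t
      = zero_ext u (knot h (int n) - t) - (\<Sum>j<N + m. w (?s - real j * h) * ?b j)"
    unfolding quasi_error_def using u[of "?s - t"] n t by (simp add: knot_def)
  also have "(\<Sum>j<N + m. w (?s - real j * h) * ?b j) = (\<Sum>j=0..n. w (?s - real j * h) * ?b j)"
  proof (rule sum.mono_neutral_right)
    show "\<forall>j\<in>{..<N + m} - {0..n}. w (?s - real j * h) * ?b j = 0"
    proof
      fix j assume "j \<in> {..<N + m} - {0..n}"
      then have "?s \<le> real j * h" using h by (intro mult_right_mono) auto
      then have "w (?s - real j * h) = 0" by (intro w_nonpos) simp
      then show "w (?s - real j * h) * ?b j = 0" by simp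
    qed
  qed (auto simp: N_def)
  also have "\<dots> = (\<Sum>j=0..n. v (n - j) * ?b j) - (\<Sum>j=0..n. coeff_error (int (n - j)) * ?b j)"
    unfolding sum_subtractf[symmetric]
  proof (rule sum.cong[OF refl])
    fix j assume j: "j \<in> {0..n}"
    have "w (?s - real j * h) = v (n - j) - coeff_error (int (n - j))"
    proof (cases "j = n")
      case True
      have "w (?s - real j * h) = 0" by (rule w_nonpos) (simp add: True)
      then show ?thesis using True by (simp add: coeff_error_def v_0)
    next
      case False
      then show ?thesis
        using j by (simp add: coeff_error_def of_nat_diff nat_diff_distrib left_diff_distrib)
    qed
    then show "w (?s - real j * h) * ?b j = v (n - j) * ?b j - coeff_error (int (n - j)) * ?b j"
      by (simp add: left_diff_distrib)
  qed
  finally have e: "approx_error u m h v n t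
      = quasi_error (U 0) (U 1) m h (N + m) ?s t - (\<Sum>j=0..n. coeff_error (int (n - j)) * ?b j)"
    by (simp add: approx_error_def)
  have "\<bar>\<Sum>j=0..n. coeff_error (int (n - j)) * ?b j\<bar> \<le> (\<Sum>j=0..n. D * ?b j)"
  proof (rule order_trans[OF sum_abs sum_mono])
    fix j assume "j \<in> {0..n}"
    have "real (n - j) * h \<le> real n * h" using h by (intro mult_right_mono) auto
    then have "\<bar>coeff_error (int (n - j))\<bar> \<le> D"
      unfolding D_def A_def using n small by (intro coeff_error_bound) (auto simp: A_def)
    then show "\<bar>coeff_error (int (n - j)) * ?b j\<bar> \<le> D * ?b j"
      using b[of j] by (simp add: abs_mult mult_right_mono)
  qed
  also have "\<dots> \<le> (\<Sum>j<N + m. D * ?b j)"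
    using b T B_nonneg by (intro sum_mono2) (auto simp: N_def D_def A_def)
  also have "\<dots> = D"
    using bspline_sum_1[OF h _ tN] t by (simp add: sum_distrib_left[symmetric])
  finally have "\<bar>\<Sum>j=0..n. coeff_error (int (n - j)) * ?b j\<bar> \<le> D" .
  moreover have "\<bar>quasi_error (U 0) (U 1) m h (N + m) ?s t\<bar>
      \<le> (if m = 1 \<or> real m * h \<le> t then 0 else 2 * real m * h * \<bar>U 1 (?s - t)\<bar>) + 2 * (real m)\<^sup>2 * B * h\<^sup>2"
    using U_deriv[of 0] U_lipschitz[of 1] B_nonneg n t tN
    by (intro quasi_error_bound[of T] h m) auto
  ultimately show ?thesis using t(2) unfolding e D_def by (simp add: distrib_right split: if_splits)
qed

end

section \<open>Constants uniform in the step size\<close>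

lemma interval_derivative_bounds:
  fixes f f' f'' :: "real \<Rightarrow> real"
  assumes T: "0 < T"
    and f: "\<And>t. t \<in> {0..T} \<Longrightarrow> (f has_real_derivative f' t) (at t within {0..T})"
    and f': "\<And>t. t \<in> {0..T} \<Longrightarrow> (f' has_real_derivative f'' t) (at t within {0..T})"
    and f'': "continuous_on {0..T} f''"
  obtains B where "\<And>t. t \<in> {0..T} \<Longrightarrow> \<bar>f t\<bar> \<le> B"
    and "\<And>t. t \<in> {0..T} \<Longrightarrow> \<bar>f t - f 0\<bar> \<le> B * t"
    and "\<And>t h. 0 < h \<Longrightarrow> 0 \<le> t \<Longrightarrow> t + 2 * h \<le> T \<Longrightarrow> \<bar>f (t + 2 * h) - 2 * f (t + h) + f t\<bar> \<le> B * h\<^sup>2"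
proof -
  have "continuous_on {0..T} f" "continuous_on {0..T} f'"
    using f f' by (meson DERIV_continuous continuous_on_eq_continuous_within)+
  then obtain B0 B1 B2 where b: "\<forall>t\<in>{0..T}. \<bar>f t\<bar> \<le> B0" "\<forall>t\<in>{0..T}. \<bar>f' t\<bar> \<le> B1" "\<forall>t\<in>{0..T}. \<bar>f'' t\<bar> \<le> B2"
    using continuous_on_Icc_abs_bound f'' by metis
  define B where "B = max B0 (max B1 B2)"
  have B: "\<bar>f t\<bar> \<le> B" "\<bar>f' t\<bar> \<le> B" "\<bar>f'' t\<bar> \<le> B" if "t \<in> {0..T}" for t
    using b that unfolding B_def by (auto simp: le_max_iff_disj)
  show ?thesis
  proof (rule that[of B])
    show "\<bar>f t - f 0\<bar> \<le> B * t" if "t \<in> {0..T}" for t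
      using field_differentiable_bound[of "{0..T}" f f' B t 0] f B(2) that by auto
    show "\<bar>f (t + 2 * h) - 2 * f (t + h) + f t\<bar> \<le> B * h\<^sup>2" if "0 < h" "0 \<le> t" "t + 2 * h \<le> T" for t h
      using second_difference_bound[of "{0..T}" h "t + 2 * h" f f' f'' B] f f' B(3) that
      by (simp add: algebra_simps)
  qed (rule B)
qed

theorem theorem4p1:
  fixes m d :: nat and T :: real and a K u :: "real \<Rightarrow> real"
  assumes "1 \<le> m" and "0 < T" and "4 \<le> d"
    and "C_k_on (d + 1) a {0..T}" and "C_k_on (d + 1) K {0..T}"
    and "K 0 = 1"
    and "\<forall>p\<le>d + 1. deriv_within {0..T} p a 0 = 0"
    and "volterra_solution K a T u"
  shows "\<exists>C. \<forall>\<^sub>F h in at_right 0. \<forall>v. scheme_coeffs K a T m h v \<longrightarrow>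
           (\<forall>n\<ge>1. knot h (int n) \<le> T \<longrightarrow>
              (\<forall>t\<in>{knot h (int m)..T}. \<bar>approx_error u m h v n t\<bar> \<le> C * h\<^sup>2) \<and>
              (m = 1 \<longrightarrow> (\<forall>t\<in>{0..T}. \<bar>approx_error u m h v n t\<bar> \<le> C * h\<^sup>2)))"
proof -
  \<comment> \<open>The argument runs with five derivatives of the data, available since
    \<open>4 \<le> d\<close>.\<close>
  have a5: "C_k_on 5 a {0..T}" and K5: "C_k_on 5 K {0..T}"
    using assms(3-5) unfolding C_k_on_def by auto
  have a0: "\<forall>p\<le>5. deriv_within {0..T} p a 0 = 0" using assms(3,7) by auto
  have cK: "continuous_on {0..T} K"
    using K5 unfolding C_k_on_def by (metis deriv_within.simps(1) zero_le)
  obtain U B\<^sub>1 where U: "\<And>t. t \<le> T \<Longrightarrow> U 0 t = zero_ext u t"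
      "\<And>i t. i \<le> 4 \<Longrightarrow> t \<le> 0 \<Longrightarrow> U i t = 0"
      "\<And>i t. i < 4 \<Longrightarrow> t \<le> T \<Longrightarrow> (U i has_real_derivative U (Suc i) t) (at t within {..T})"
      "\<And>i t. i \<le> 4 \<Longrightarrow> t \<le> T \<Longrightarrow> \<bar>U i t\<bar> \<le> B\<^sub>1"
    by (rule zero_ext_regularity[OF assms(2) a5 K5 assms(6) a0 assms(8)]) blast
  have K_deriv: "(deriv_within {0..T} i K has_real_derivative deriv_within {0..T} (Suc i) K t) (at t within {0..T})"
    if "i < 5" "t \<in> {0..T}" for i t
    using C_k_on_deriv[OF K5 that] .
  have dK: "(K has_real_derivative deriv_within {0..T} 1 K t) (at t within {0..T})"
    "(deriv_within {0..T} 1 K has_real_derivative deriv_within {0..T} 2 K t) (at t within {0..T})"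
    if "t \<in> {0..T}" for t
    using K_deriv[of 0 t] K_deriv[of 1 t] that by (simp_all add: numeral_2_eq_2)
  have "(2::nat) \<le> 5" by simp
  then have c2: "continuous_on {0..T} (deriv_within {0..T} 2 K)"
    using K5 unfolding C_k_on_def by blast
  obtain B\<^sub>2 where K: "\<And>t. t \<in> {0..T} \<Longrightarrow> \<bar>K t\<bar> \<le> B\<^sub>2" "\<And>t. t \<in> {0..T} \<Longrightarrow> \<bar>K t - K 0\<bar> \<le> B\<^sub>2 * t"
    "\<And>t h. 0 < h \<Longrightarrow> 0 \<le> t \<Longrightarrow> t + 2 * h \<le> T \<Longrightarrow> \<bar>K (t + 2 * h) - 2 * K (t + h) + K t\<bar> \<le> B\<^sub>2 * h\<^sup>2"
    by (rule interval_derivative_bounds[OF assms(2) dK c2]) (assumption, assumption, blast)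
  \<comment> \<open>\<open>B\<close>, \<open>A\<close> and \<open>C\<close> are fixed before
    \<open>h\<close>; \<open>A\<close> and \<open>C\<close> are built as in
    \<open>approx_error_bound\<close>.\<close>
  define B where "B = max B\<^sub>1 B\<^sub>2"
  define A where "A = real (m + 1) * (B * (4 * (real (m + 2))\<^sup>2 + T) + 2 * (real m)\<^sup>2 * B\<^sup>2 * (1 + T))"
  define C where "C = 2 * (real m)\<^sup>2 * B + T * A * exp (2 * A * T)"
  \<comment> \<open>Sufficiently small means: Gronwall applies, and the leading weight is nonzero,
    which forces \<open>v 0 = 0\<close>.\<close>
  have "\<forall>\<^sub>F h in at_right 0. 2 * A * h \<le> 1"
  proof -
    have "((\<lambda>h. 2 * A * h) \<longlongrightarrow> 2 * A * 0) (at_right 0)" by (intro tendsto_intros)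
    then have "\<forall>\<^sub>F h in at_right 0. 2 * A * h < 1" by (rule order_tendstoD) simp
    then show ?thesis by eventually_elim simp
  qed
  moreover have "\<forall>\<^sub>F h in at_right (0::real). 0 < h" by (simp add: eventually_at_right_less)
  moreover have "\<forall>\<^sub>F h in at_right 0. weight K m h 0 \<noteq> 0"
    by (rule weight_0_nonzero[OF cK assms(6,2)])
  ultimately have "\<forall>\<^sub>F h in at_right 0. \<forall>v. scheme_coeffs K a T m h v \<longrightarrow>
           (\<forall>n\<ge>1. knot h (int n) \<le> T \<longrightarrow>
              (\<forall>t\<in>{knot h (int m)..T}. \<bar>approx_error u m h v n t\<bar> \<le> C * h\<^sup>2) \<and>
              (m = 1 \<longrightarrow> (\<forall>t\<in>{0..T}. \<bar>approx_error u m h v n t\<bar> \<le> C * h\<^sup>2)))"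
  proof eventually_elim
    case (elim h)
    have le: "B\<^sub>1 \<le> B" "B\<^sub>2 \<le> B" by (auto simp: B_def)
    have scheme: "convolution_scheme K a U v T h B m" if "scheme_coeffs K a T m h v" for v
    proof
      show "\<bar>K t - 1\<bar> \<le> B * t" if "t \<in> {0..T}" for t
        using K(2)[OF that] mult_right_mono[OF le(2), of t] that assms(6) by auto
      show "\<bar>K (t + 2 * h) - 2 * K (t + h) + K t\<bar> \<le> B * h\<^sup>2" if "0 \<le> t" "t + 2 * h \<le> T" for t
        using K(3)[OF elim(2) that] mult_right_mono[OF le(2), of "h\<^sup>2"] by simp
      show "integral {0..t} (\<lambda>s. K s * U 0 (t - s)) = a t" if t: "t \<in> {0..T}" for t
      proof -
        have "integral {0..t} (\<lambda>s. K s * U 0 (t - s)) = integral {0..t} (\<lambda>s. K s * u (t - s))"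
          using t by (intro integral_cong) (auto simp: U(1) zero_ext_def)
        then show ?thesis using assms(8) t by (simp add: volterra_solution_def)
      qed
      show "\<bar>K t\<bar> \<le> B" if "t \<in> {0..T}" for t using K(1)[OF that] le by linarith
      show "\<bar>U i t\<bar> \<le> B" if "i \<le> 4" "t \<le> T" for i t using U(4)[OF that] le by linarith
    qed (use assms elim that U cK in auto)
    have bound: "\<bar>approx_error u m h v n t\<bar> \<le> C * h\<^sup>2"
      if "scheme_coeffs K a T m h v" "knot h (int n) \<le> T" "t \<in> {0..T}" "m = 1 \<or> real m * h \<le> t" for v n t
      using convolution_scheme.approx_error_bound[OF scheme[OF that(1)] U(1), of n t] that elim(1)
      unfolding C_def A_def by (simp add: knot_def)
    have "0 \<le> real m * h" using elim by simp
    then have "real m * h \<le> t \<and> t \<in> {0..T}" if "t \<in> {knot h (int m)..T}" for t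
      using that by (simp add: knot_def)
    then show ?case by (intro allI impI conjI ballI bound) blast+
  qed
  then show ?thesis by blast
qed

end
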